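(* Let $p>2$ and let $G$ be a locally finite and bounded metric graph. Then there exists at least one $v\in H^1_0(G)\setminus\{0\}$ attaining the infimum $$\frac1{C_p(G)}=\inf_{w\in H^1_0(G)\setminus\{0\}}\frac{\int_G(|w'|^2+|w|^2)\,dx}{\left(\int_G|w|^p\,dx\right)^{2/p}},$$ and therefore the constant $C_p(G)$ is achieved in the inequality $\left(\int_G|w|^p\,dx\right)^{2/p}\le C_p(G)\int_G(|w'|^2+|w|^2)\,dx$, $w\in H^1_0(G)$.
   Context: A (planar, metric) graph $G$ consists of vertices and of edges, each edge being either a straight segment joining two vertices (bounded edge, of positive length equal to the distance between its endpoints) or a half-line issued from one vertex (unbounded edge, of infinite length). The graph is locally finite: there is no accumulation of edges at any vertex. A bounded locally finite graph is compact, i.e. it has finitely many edges, all of finite length. A vertex is outer if it belongs to only one edge, and inner otherwise. Integrals over $G$ are sums over the edges of integrals with respect to arc length. $H^1(G)$ is the set of continuous functions on $G$ belonging to $H^1(e)$ for each edge $e$ with $\|f\|_{H^1(G)}^2=\sum_e\|f\|_{H^1(e)}^2<\infty$; $H^1_0(G)$ is the subspace of functions vanishing at all outer vertices (Dirichlet condition). $C_p(G)$ is the best constant in the inequality of the claim. *)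

theory Defs
  imports "HOL-Analysis.Analysis"
begin

subsection \<open>Metric graphs in the plane\<close>

type_synonym point = "real ^ 2"

text \<open>The order of the two endpoints of a segment only fixes an orientation for its arc-length
  parametrisation. The second argument of \<open>Halfline\<close> is its direction, a unit vector in every
  \<open>metric_graph\<close> below.\<close>

datatype edge = Segment point point | Halfline point point

fun edge_points :: "edge \<Rightarrow> point set" where
  "edge_points (Segment a b) = closed_segment a b"
| "edge_points (Halfline a u) = {a + t *\<^sub>R u | t. 0 \<le> t}"

fun edge_ends :: "edge \<Rightarrow> point set" where
  "edge_ends (Segment a b) = {a, b}"
| "edge_ends (Halfline a u) = {a}"

fun edge_param :: "edge \<Rightarrow> real \<Rightarrow> point" where
  "edge_param (Segment a b) t = a + t *\<^sub>R sgn (b - a)"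
| "edge_param (Halfline a u) t = a + t *\<^sub>R u"

text \<open>The open interval of arc-length parameters of an edge.\<close>

fun edge_interval :: "edge \<Rightarrow> real set" where
  "edge_interval (Segment a b) = {0 <..< dist a b}"
| "edge_interval (Halfline a u) = {0 <..}"

record plane_graph =
  verts :: "point set"
  edges :: "edge set"

definition graph_points :: "plane_graph \<Rightarrow> point set" where
  "graph_points G = verts G \<union> (\<Union>e\<in>edges G. edge_points e)"

text \<open>The graph is nonempty and has no isolated vertices: it is the union of its edges.
  Connectedness is not required. By \<open>planar\<close>, two edges may share common endpoints only; in
  particular an edge is not listed twice (with both orientations, say), and there is no vertex in
  the relative interior of an edge.\<close>

locale metric_graph =
  fixes G :: plane_graph
  assumes nonempty: "edges G \<noteq> {}"
    and segment: "Segment a b \<in> edges G \<Longrightarrow> a \<noteq> b"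
    and halfline: "Halfline a u \<in> edges G \<Longrightarrow> norm u = 1"
    and verts_eq: "verts G = (\<Union>e\<in>edges G. edge_ends e)"
    and planar: "e \<in> edges G \<Longrightarrow> e' \<in> edges G \<Longrightarrow> e \<noteq> e' \<Longrightarrow>
      edge_points e \<inter> edge_points e' \<subseteq> edge_ends e \<inter> edge_ends e'"

definition outer :: "plane_graph \<Rightarrow> point set" where
  "outer G = {x \<in> verts G. \<exists>!e. e \<in> edges G \<and> x \<in> edge_points e}"

text \<open>Accumulation of edges is excluded at every point of the plane, not only at the vertices.
  Otherwise bounded locally finite graphs need not be compact: take the segments from
  \<open>(1/n, 0)\<close> to \<open>(1/n, 1)\<close>, which accumulate at no vertex.\<close>

definition locally_finite_graph :: "plane_graph \<Rightarrow> bool" where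
  "locally_finite_graph G \<longleftrightarrow>
    (\<forall>x. \<exists>\<epsilon>>0. finite {e \<in> edges G. edge_points e \<inter> ball x \<epsilon> \<noteq> {}})"

definition bounded_graph :: "plane_graph \<Rightarrow> bool" where
  "bounded_graph G \<longleftrightarrow> bounded (graph_points G)"

subsection \<open>Sobolev spaces\<close>

definition square_integrable :: "real set \<Rightarrow> (real \<Rightarrow> real) \<Rightarrow> bool" where
  "square_integrable J f \<longleftrightarrow>
    set_borel_measurable lborel J f \<and> set_integrable lborel J (\<lambda>t. (f t)\<^sup>2)"

text \<open>On an open interval, \<open>C\<^sup>1\<close> test functions define the same weak derivatives as smooth
  ones; this is the convention of Brezis, Functional Analysis, Sobolev Spaces and Partial
  Differential Equations, Section 8.2.\<close>

definition test_function :: "real set \<Rightarrow> (real \<Rightarrow> real) \<Rightarrow> bool" where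
  "test_function J \<phi> \<longleftrightarrow> \<phi> C1_differentiable_on UNIV \<and>
    compact (closure {t. \<phi> t \<noteq> 0}) \<and> closure {t. \<phi> t \<noteq> 0} \<subseteq> J"

definition weak_derivative :: "real set \<Rightarrow> (real \<Rightarrow> real) \<Rightarrow> (real \<Rightarrow> real) \<Rightarrow> bool" where
  "weak_derivative J f g \<longleftrightarrow>
    (\<forall>\<phi>. test_function J \<phi> \<longrightarrow> (LBINT t:J. f t * deriv \<phi> t) = - (LBINT t:J. g t * \<phi> t))"

definition H1_interval :: "real set \<Rightarrow> (real \<Rightarrow> real) set" where
  "H1_interval J =
    {f. square_integrable J f \<and> (\<exists>g. square_integrable J g \<and> weak_derivative J f g)}"

text \<open>The weak derivative is unique up to a null set, so integrals over \<open>J\<close> do not depend on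
  the choice.\<close>

definition wderiv :: "real set \<Rightarrow> (real \<Rightarrow> real) \<Rightarrow> real \<Rightarrow> real" where
  "wderiv J f = (SOME g. square_integrable J g \<and> weak_derivative J f g)"

text \<open>Functions on the graph are functions on the plane of which only the values on
  \<open>graph_points G\<close> matter.\<close>

definition on_edge :: "(point \<Rightarrow> real) \<Rightarrow> edge \<Rightarrow> real \<Rightarrow> real" where
  "on_edge w e t = w (edge_param e t)"

definition edge_deriv :: "(point \<Rightarrow> real) \<Rightarrow> edge \<Rightarrow> real \<Rightarrow> real" where
  "edge_deriv w e = wderiv (edge_interval e) (on_edge w e)"

text \<open>The integrand is given edge by edge, in the arc-length parameter.\<close>

definition graph_integral :: "plane_graph \<Rightarrow> (edge \<Rightarrow> real \<Rightarrow> real) \<Rightarrow> real" where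
  "graph_integral G h = (\<Sum>\<^sub>\<infinity>e\<in>edges G. LBINT t:edge_interval e. h e t)"

definition H1_edge_norm :: "edge \<Rightarrow> (point \<Rightarrow> real) \<Rightarrow> real" where
  "H1_edge_norm e w =
    sqrt (LBINT t:edge_interval e. \<bar>edge_deriv w e t\<bar>\<^sup>2 + \<bar>on_edge w e t\<bar>\<^sup>2)"

definition H1 :: "plane_graph \<Rightarrow> (point \<Rightarrow> real) set" where
  "H1 G = {w. continuous_on (graph_points G) w \<and>
    (\<forall>e\<in>edges G. on_edge w e \<in> H1_interval (edge_interval e)) \<and>
    (\<lambda>e. (H1_edge_norm e w)\<^sup>2) summable_on edges G}"

definition H10 :: "plane_graph \<Rightarrow> (point \<Rightarrow> real) set" where
  "H10 G = {w \<in> H1 G. \<forall>x\<in>outer G. w x = 0}"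

definition H10_nonzero :: "plane_graph \<Rightarrow> (point \<Rightarrow> real) set" where
  "H10_nonzero G = {w \<in> H10 G. \<exists>x\<in>graph_points G. w x \<noteq> 0}"

subsection \<open>The Sobolev inequality and its best constant\<close>

definition H1_energy :: "plane_graph \<Rightarrow> (point \<Rightarrow> real) \<Rightarrow> real" where
  "H1_energy G w = graph_integral G (\<lambda>e t. \<bar>edge_deriv w e t\<bar>\<^sup>2 + \<bar>on_edge w e t\<bar>\<^sup>2)"

definition Lp_norm_sq :: "real \<Rightarrow> plane_graph \<Rightarrow> (point \<Rightarrow> real) \<Rightarrow> real" where
  "Lp_norm_sq p G w = graph_integral G (\<lambda>e t. \<bar>on_edge w e t\<bar> powr p) powr (2 / p)"

definition best_constant :: "real \<Rightarrow> plane_graph \<Rightarrow> real" where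
  "best_constant p G = Inf {C. \<forall>w\<in>H10 G. Lp_norm_sq p G w \<le> C * H1_energy G w}"

subsection \<open>Compactness\<close>

lemma (in metric_graph) bounded_locally_finite_imp_compact:
  assumes "locally_finite_graph G" and "bounded_graph G"
  shows "finite (edges G)" and "\<And>e. e \<in> edges G \<Longrightarrow> \<exists>a b. e = Segment a b"
    and "compact (graph_points G)"
proof -
  have bd: "bounded (graph_points G)"
    using assms(2) by (simp add: bounded_graph_def)
  obtain r where
    "\<forall>x. r x > 0 \<and> finite {e \<in> edges G. edge_points e \<inter> ball x (r x) \<noteq> {}}"
    using choice[OF assms(1)[unfolded locally_finite_graph_def]] by blast
  then have r: "r x > 0" "finite {e \<in> edges G. edge_points e \<inter> ball x (r x) \<noteq> {}}" for x
    by auto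
  have "compact (closure (graph_points G))"
    using bd by simp
  moreover have "closure (graph_points G) \<subseteq> (\<Union>x\<in>UNIV. ball x (r x))"
    using r(1) by (meson UN_I UNIV_I centre_in_ball subsetI)
  ultimately obtain X where X: "finite X" "closure (graph_points G) \<subseteq> (\<Union>x\<in>X. ball x (r x))"
    using compactE_image[of "closure (graph_points G)" UNIV "\<lambda>x. ball x (r x)"] open_ball
    by metis
  have ne: "edge_points e \<noteq> {}" for e
    by (cases e) auto
  have "edges G \<subseteq> (\<Union>x\<in>X. {e \<in> edges G. edge_points e \<inter> ball x (r x) \<noteq> {}})"
  proof
    fix e assume e: "e \<in> edges G"
    obtain y where y: "y \<in> edge_points e" using ne by blast
    have "y \<in> graph_points G"
      using e y by (auto simp: graph_points_def)
    then have "y \<in> (\<Union>x\<in>X. ball x (r x))"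
      using closure_subset X(2) by (meson subsetD)
    then obtain x where "x \<in> X" "y \<in> ball x (r x)" by (rule UN_E)
    then show "e \<in> (\<Union>x\<in>X. {e \<in> edges G. edge_points e \<inter> ball x (r x) \<noteq> {}})"
      using e y by (intro UN_I[of x] CollectI conjI) auto
  qed
  then show fin: "finite (edges G)"
    using X(1) r(2) by (meson finite_UN_I finite_subset)
  show seg: "\<exists>a b. e = Segment a b" if e: "e \<in> edges G" for e
  proof (cases e)
    case (Halfline a u)
    have u: "norm u = 1" using halfline e Halfline by blast
    obtain B where B: "\<And>x. x \<in> graph_points G \<Longrightarrow> norm x \<le> B"
      using bd by (auto simp: bounded_iff)
    define t where "t = \<bar>B\<bar> + norm a + 1"
    have "a + t *\<^sub>R u \<in> edge_points e"
    proof -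
      have "0 \<le> t" by (simp add: t_def)
      then show ?thesis unfolding Halfline edge_points.simps by blast
    qed
    then have "norm (a + t *\<^sub>R u) \<le> B"
      using B[of "a + t *\<^sub>R u"] e unfolding graph_points_def by blast
    moreover have "t \<le> norm (a + t *\<^sub>R u) + norm a"
      using norm_triangle_ineq4[of "a + t *\<^sub>R u" a] u by (simp add: t_def)
    ultimately show ?thesis by (simp add: t_def)
  qed auto
  have ends: "edge_ends e \<subseteq> edge_points e" for e
  proof (cases e)
    case (Halfline a u)
    have "a = a + 0 *\<^sub>R u" by simp
    then have "a \<in> {a + t *\<^sub>R u | t. 0 \<le> t}" by blast
    then show ?thesis unfolding Halfline by simp
  qed auto
  have eq: "graph_points G = (\<Union>e\<in>edges G. edge_points e)"
    using ends unfolding graph_points_def verts_eq by blast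
  have "compact (edge_points e)" if "e \<in> edges G" for e
    using seg[OF that] by (metis compact_segment(1) edge_points.simps(1))
  then show "compact (graph_points G)"
    unfolding eq using fin by (intro compact_UN) auto
qed

end

theory Submission
  imports Defs "HOL-Complex_Analysis.Great_Picard"
begin

text \<open>A minimising sequence, normalised to have \<open>L\<^sup>p\<close> norm \<open>1\<close>, is bounded and equicontinuous by the
  one-dimensional Sobolev estimates, so by Arzela--Ascoli a subsequence \<open>w\<^sub>n\<close> converges uniformly to
  some \<open>v\<close> of norm \<open>1\<close>. Weak compactness is not needed: \<open>(w\<^sub>i + w\<^sub>j) / 2\<close> also has norm close to
  \<open>1\<close>, hence energy at least almost the infimum, and the parallelogram identity makes \<open>w\<^sub>n\<close> a
  Cauchy sequence for the energy. Completeness of \<open>L\<^sup>2\<close> on each edge shows that \<open>v\<close> has a square-integrable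
  weak derivative and that its energy is the limit.\<close>

subsection \<open>Square-integrable functions on a finite measure space\<close>

text \<open>The definitions see a function on an edge only through test functions with compact
  support in an open interval, and \<open>wderiv\<close> picks one weak derivative by
  \<open>SOME\<close>; the argument needs endpoint values and an energy that is a quadratic form.
  One identity bridges both gaps: testing with approximate indicators expresses
  \<open>f t - f s\<close> as the integral of any weak derivative over \<open>(s, t)\<close>, the
  endpoints \<open>0\<close> and \<open>L\<close> included. Hence weak derivatives are unique almost
  everywhere and the energy may be computed with any of them; with Cauchy-Schwarz the same identity
  gives the Hoelder-1/2 bound and the sup bound behind equicontinuity and boundedness. The graph
  enters in two ways. Having finitely many compact edges turns edgewise estimates into estimates on
  all of \<open>G\<close>. Planarity lets a bump on one edge be extended by zero, so that the
  infimum is not taken over an empty set. That the infimum is positive comes out last, from the sup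
  bound at a point where the minimiser does not vanish.\<close>

definition L2_function :: "'a measure \<Rightarrow> ('a \<Rightarrow> real) \<Rightarrow> bool" where
  "L2_function M f \<longleftrightarrow> f \<in> borel_measurable M \<and> integrable M (\<lambda>x. (f x)\<^sup>2)"

lemma L2_function_integrable_square: "L2_function M f \<Longrightarrow> integrable M (\<lambda>x. (f x)\<^sup>2)"
  by (auto simp: L2_function_def)

lemma L2_function_integrable_mult:
  assumes "L2_function M f" and "L2_function M g"
  shows "integrable M (\<lambda>x. f x * g x)"
proof (rule Bochner_Integration.integrable_bound[where f="\<lambda>x. (f x)\<^sup>2 + (g x)\<^sup>2"])
  show "AE x in M. norm (f x * g x) \<le> norm ((f x)\<^sup>2 + (g x)\<^sup>2)"
  proof (rule AE_I2)
    fix x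
    have "2 * (\<bar>f x\<bar> * \<bar>g x\<bar>) \<le> (f x)\<^sup>2 + (g x)\<^sup>2"
      using sum_squares_bound[of "\<bar>f x\<bar>" "\<bar>g x\<bar>"] by (simp add: mult.assoc)
    moreover have "0 \<le> \<bar>f x\<bar> * \<bar>g x\<bar>" by simp
    ultimately have "\<bar>f x\<bar> * \<bar>g x\<bar> \<le> (f x)\<^sup>2 + (g x)\<^sup>2" by linarith
    then show "norm (f x * g x) \<le> norm ((f x)\<^sup>2 + (g x)\<^sup>2)"
      by (simp add: abs_mult)
  qed
qed (use assms in \<open>auto simp: L2_function_def\<close>)

lemma L2_function_cmult: "L2_function M f \<Longrightarrow> L2_function M (\<lambda>x. c * f x)"
  by (auto simp: L2_function_def power_mult_distrib)

lemma L2_function_add: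
  assumes "L2_function M f" and "L2_function M g"
  shows "L2_function M (\<lambda>x. f x + g x)"
  using assms L2_function_integrable_mult[OF assms]
  by (auto simp: L2_function_def power2_sum mult.assoc)

lemma L2_function_diff:
  assumes "L2_function M f" and "L2_function M g"
  shows "L2_function M (\<lambda>x. f x - g x)"
  using L2_function_add[OF assms(1) L2_function_cmult[OF assms(2), of "-1"]] by simp

lemma L2_function_bounded:
  assumes "finite_measure M" and [measurable]: "f \<in> borel_measurable M"
    and "\<And>x. x \<in> space M \<Longrightarrow> \<bar>f x\<bar> \<le> B"
  shows "L2_function M f"
proof -
  interpret finite_measure M by fact
  have "integrable M (\<lambda>x. (f x)\<^sup>2)"
  proof (rule integrable_const_bound[where B="B\<^sup>2"])
    show "AE x in M. norm ((f x)\<^sup>2) \<le> B\<^sup>2"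
    proof (rule AE_I2)
      fix x assume "x \<in> space M"
      then have "\<bar>f x\<bar>\<^sup>2 \<le> B\<^sup>2" using assms(3) by (intro power_mono) auto
      then show "norm ((f x)\<^sup>2) \<le> B\<^sup>2" by simp
    qed
  qed simp
  then show ?thesis by (simp add: L2_function_def)
qed

lemma L2_function_integrable:
  assumes "finite_measure M" and "L2_function M f"
  shows "integrable M f"
  using L2_function_integrable_mult[OF assms(2) L2_function_bounded[OF assms(1), of "\<lambda>_. 1" 1]]
  by simp

text \<open>The integral of \<open>(f + r * g)\<^sup>2\<close> is a nonnegative quadratic polynomial
  in \<open>r\<close>, so its discriminant is not positive.\<close>

lemma L2_Cauchy_Schwarz:
  assumes f: "L2_function M f" and g: "L2_function M g"
  shows "(LINT x|M. f x * g x)\<^sup>2 \<le> (LINT x|M. (f x)\<^sup>2) * (LINT x|M. (g x)\<^sup>2)"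
proof -
  define A B C where "A = (LINT x|M. (f x)\<^sup>2)" and "B = (LINT x|M. f x * g x)"
    and "C = (LINT x|M. (g x)\<^sup>2)"
  have quad: "0 \<le> A + 2 * r * B + r\<^sup>2 * C" for r
  proof -
    have "A + 2 * r * B + r\<^sup>2 * C = (LINT x|M. (f x)\<^sup>2 + 2 * r * (f x * g x) + r\<^sup>2 * (g x)\<^sup>2)"
      unfolding A_def B_def C_def
      using L2_function_integrable_mult[OF f g] f g
      by (simp add: L2_function_integrable_square)
    also have "\<dots> = (LINT x|M. (f x + r * g x)\<^sup>2)"
      by (rule Bochner_Integration.integral_cong) (auto simp: power2_sum algebra_simps power2_eq_square)
    also have "\<dots> \<ge> 0" by simp
    finally show ?thesis .
  qed
  have C: "0 \<le> C" by (simp add: C_def)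
  have "B\<^sup>2 \<le> A * C"
  proof (cases "C = 0")
    case True
    have "B = 0"
    proof (rule ccontr)
      assume "B \<noteq> 0"
      \<comment> \<open>With \<open>C = 0\<close> this \<open>r\<close> gives the polynomial the
        value \<open>-1\<close>.\<close>
      then show False using quad[of "- (A + 1) / (2 * B)"] True by (simp add: field_simps)
    qed
    then show ?thesis using True by simp
  next
    case False
    then have "C > 0" using C by simp
    \<comment> \<open>The polynomial is smallest at \<open>r = - B / C\<close>.\<close>
    have "0 \<le> C * (A + 2 * (- B / C) * B + (- B / C)\<^sup>2 * C)"
      using quad C by (intro mult_nonneg_nonneg)
    also have "\<dots> = A * C - B\<^sup>2"
      using \<open>C > 0\<close> by (simp add: field_simps power2_eq_square)
    finally show ?thesis by simp
  qed
  then show ?thesis by (simp add: A_def B_def C_def)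
qed

text \<open>Cauchy-Schwarz for \<open>g n - g'\<close> against \<open>h\<close>: strong convergence
  implies weak convergence.\<close>

lemma L2_limit_integral_mult:
  assumes g: "\<And>n. L2_function M (g n)" "L2_function M g'" and h: "L2_function M h"
    and lim: "(\<lambda>n. LINT x|M. (g n x - g' x)\<^sup>2) \<longlonglongrightarrow> 0"
  shows "(\<lambda>n. LINT x|M. g n x * h x) \<longlonglongrightarrow> (LINT x|M. g' x * h x)"
proof -
  have "(\<lambda>n. (LINT x|M. (g n x - g' x) * h x)\<^sup>2) \<longlonglongrightarrow> 0"
  proof (rule tendsto_sandwich[OF _ _ tendsto_const])
    show "\<forall>\<^sub>F n in sequentially. (LINT x|M. (g n x - g' x) * h x)\<^sup>2
        \<le> (LINT x|M. (g n x - g' x)\<^sup>2) * (LINT x|M. (h x)\<^sup>2)"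
      using L2_Cauchy_Schwarz[OF L2_function_diff[OF g] h] by simp
    show "(\<lambda>n. (LINT x|M. (g n x - g' x)\<^sup>2) * (LINT x|M. (h x)\<^sup>2)) \<longlonglongrightarrow> 0"
      using tendsto_mult_right[OF lim, of "LINT x|M. (h x)\<^sup>2"] by simp
  qed simp
  then have "(\<lambda>n. LINT x|M. (g n x - g' x) * h x) \<longlonglongrightarrow> 0"
    by (simp add: power_tendsto_0_iff)
  moreover have "(LINT x|M. (g n x - g' x) * h x) = (LINT x|M. g n x * h x) - (LINT x|M. g' x * h x)" for n
    using L2_function_integrable_mult[OF _ h] g by (simp add: left_diff_distrib)
  ultimately show ?thesis by (simp add: LIM_zero_iff)
qed

text \<open>Expanding \<open>(g n - g')\<^sup>2\<close> leaves a pairing with the fixed function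
  \<open>g'\<close>, whose limit is known from weak convergence.\<close>

lemma L2_limit_integral_square:
  assumes g: "\<And>n. L2_function M (g n)" "L2_function M g'"
    and lim: "(\<lambda>n. LINT x|M. (g n x - g' x)\<^sup>2) \<longlonglongrightarrow> 0"
  shows "(\<lambda>n. LINT x|M. (g n x)\<^sup>2) \<longlonglongrightarrow> (LINT x|M. (g' x)\<^sup>2)"
proof -
  have "(\<lambda>n. (LINT x|M. (g n x - g' x)\<^sup>2) + 2 * (LINT x|M. g n x * g' x) - (LINT x|M. g' x * g' x))
      \<longlonglongrightarrow> 0 + 2 * (LINT x|M. g' x * g' x) - (LINT x|M. g' x * g' x)"
    using L2_limit_integral_mult[OF g(1) g(2) g(2) lim] lim by (intro tendsto_intros)
  moreover have "(LINT x|M. (g n x - g' x)\<^sup>2) + 2 * (LINT x|M. g n x * g' x) - (LINT x|M. g' x * g' x)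
      = (LINT x|M. (g n x)\<^sup>2)" for n
  proof -
    have "(LINT x|M. (g n x - g' x)\<^sup>2) = (LINT x|M. (g n x)\<^sup>2 - 2 * (g n x * g' x) + g' x * g' x)"
      by (rule Bochner_Integration.integral_cong) (auto simp: power2_eq_square algebra_simps)
    also have "\<dots> = (LINT x|M. (g n x)\<^sup>2) - 2 * (LINT x|M. g n x * g' x) + (LINT x|M. g' x * g' x)"
      using g L2_function_integrable_mult[OF g(1)[of n] g(2)] L2_function_integrable_mult[OF g(2) g(2)]
      by (simp add: L2_function_integrable_square)
    finally show ?thesis by simp
  qed
  ultimately show ?thesis by (simp add: power2_eq_square)
qed

text \<open>Riesz-Fischer. On a finite measure space, Cauchy-Schwarz against the constant 1 makes
  the sequence Cauchy in L1, so a subsequence converges almost everywhere; Fatou's lemma along it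
  bounds the distance from each late \<open>g n\<close> to the limit.\<close>

lemma L2_complete:
  assumes M: "finite_measure M" and g: "\<And>n. L2_function M (g n)"
    and cauchy: "\<And>e. e > 0 \<Longrightarrow> \<exists>N. \<forall>i\<ge>N. \<forall>j\<ge>N. (LINT x|M. (g i x - g j x)\<^sup>2) < e"
  obtains g' where "L2_function M g'" and "(\<lambda>n. LINT x|M. (g n x - g' x)\<^sup>2) \<longlonglongrightarrow> 0"
proof -
  interpret finite_measure M by fact
  have gm [measurable]: "g n \<in> borel_measurable M" for n using g by (simp add: L2_function_def)
  have one: "L2_function M (\<lambda>_. 1)" by (rule L2_function_bounded[OF M, where B=1]) auto
  have L1: "\<exists>N. \<forall>i\<ge>N. \<forall>j\<ge>N. LINT x|M. norm (g i x - g j x) < e" if e: "e > 0" for e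
  proof -
    \<comment> \<open>The \<open>+ 1\<close> keeps the divisor \<open>K\<close> positive even if the
      whole space has measure 0.\<close>
    define K where "K = measure M (space M) + 1"
    have K: "K > 0" by (simp add: K_def add_nonneg_pos)
    obtain N where N: "\<And>i j. i \<ge> N \<Longrightarrow> j \<ge> N \<Longrightarrow> (LINT x|M. (g i x - g j x)\<^sup>2) < e\<^sup>2 / K"
      using cauchy[of "e\<^sup>2 / K"] e K by auto
    have "LINT x|M. norm (g i x - g j x) < e" if "i \<ge> N" "j \<ge> N" for i j
    proof -
      have d: "L2_function M (\<lambda>x. \<bar>g i x - g j x\<bar>)"
        using L2_function_diff[OF g[of i] g[of j]] by (auto simp: L2_function_def)
      have "(LINT x|M. \<bar>g i x - g j x\<bar> * 1)\<^sup>2 \<le> (LINT x|M. \<bar>g i x - g j x\<bar>\<^sup>2) * (LINT x|M. 1\<^sup>2)"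
        by (rule L2_Cauchy_Schwarz[OF d one])
      also have "\<dots> \<le> (LINT x|M. (g i x - g j x)\<^sup>2) * K"
        by (intro mult_mono) (auto simp: K_def)
      also have "\<dots> < e\<^sup>2"
        using N[OF that] K by (simp add: pos_less_divide_eq)
      finally show ?thesis using e by (auto intro: power2_less_imp_less)
    qed
    then show ?thesis by blast
  qed
  obtain r where r: "strict_mono r" "AE x in M. Cauchy (\<lambda>i. g (r i) x)"
    using cauchy_L1_AE_cauchy_subseq[OF L2_function_integrable[OF M g] L1] by blast
  define g' where "g' x = lim (\<lambda>i. g (r i) x)" for x
  have g'm [measurable]: "g' \<in> borel_measurable M" unfolding g'_def by measurable
  have conv: "AE x in M. (\<lambda>i. g (r i) x) \<longlonglongrightarrow> g' x"
    using r(2) by eventually_elim (simp add: g'_def Cauchy_convergent_iff convergent_LIMSEQ_iff)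
  \<comment> \<open>Square integrability of the difference is part of the claim because
    \<open>g'\<close> is not yet known to be in L2; a single index \<open>N1\<close> then settles
    that.\<close>
  have fatou: "L2_function M (\<lambda>x. g n x - g' x) \<and> (LINT x|M. (g n x - g' x)\<^sup>2) \<le> e"
    if e: "e > 0" and N: "\<forall>j\<ge>N. (LINT x|M. (g n x - g j x)\<^sup>2) < e" for n N e
  proof -
    have "(\<integral>\<^sup>+x. ennreal ((g n x - g' x)\<^sup>2) \<partial>M)
        = (\<integral>\<^sup>+x. liminf (\<lambda>i. ennreal ((g n x - g (r i) x)\<^sup>2)) \<partial>M)"
    proof (rule nn_integral_cong_AE)
      show "AE x in M. ennreal ((g n x - g' x)\<^sup>2) = liminf (\<lambda>i. ennreal ((g n x - g (r i) x)\<^sup>2))"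
        using conv
      proof eventually_elim
        case (elim x)
        have "(\<lambda>i. ennreal ((g n x - g (r i) x)\<^sup>2)) \<longlonglongrightarrow> ennreal ((g n x - g' x)\<^sup>2)"
          using elim by (intro tendsto_intros)
        then show ?case by (metis lim_imp_Liminf trivial_limit_sequentially)
      qed
    qed
    also have "\<dots> \<le> liminf (\<lambda>i. \<integral>\<^sup>+x. ennreal ((g n x - g (r i) x)\<^sup>2) \<partial>M)"
      by (rule nn_integral_liminf) simp
    also have "\<dots> \<le> liminf (\<lambda>i. ennreal e)"
    proof (rule Liminf_mono)
      show "\<forall>\<^sub>F i in sequentially. (\<integral>\<^sup>+x. ennreal ((g n x - g (r i) x)\<^sup>2) \<partial>M) \<le> ennreal e"
        unfolding eventually_sequentially
      proof (intro exI[of _ N] allI impI)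
        fix i assume "N \<le> i"
        then have "N \<le> r i" using seq_suble[OF r(1), of i] by linarith
        then have "(LINT x|M. (g n x - g (r i) x)\<^sup>2) < e" using N by blast
        then show "(\<integral>\<^sup>+x. ennreal ((g n x - g (r i) x)\<^sup>2) \<partial>M) \<le> ennreal e"
          using L2_function_integrable_square[OF L2_function_diff[OF g g]]
          by (subst nn_integral_eq_integral) (auto intro: ennreal_leI)
      qed
    qed
    also have "\<dots> = ennreal e" by (simp add: Liminf_const)
    finally have le: "(\<integral>\<^sup>+x. ennreal ((g n x - g' x)\<^sup>2) \<partial>M) \<le> ennreal e" .
    have int: "integrable M (\<lambda>x. (g n x - g' x)\<^sup>2)"
    proof (rule integrableI_bounded)
      show "(\<integral>\<^sup>+x. ennreal (norm ((g n x - g' x)\<^sup>2)) \<partial>M) < \<infinity>"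
        using le_less_trans[OF le ennreal_less_top] by simp
    qed simp
    have "(LINT x|M. (g n x - g' x)\<^sup>2) \<le> e"
      using le e by (subst (asm) nn_integral_eq_integral[OF int]) auto
    then show ?thesis using int by (simp add: L2_function_def)
  qed
  obtain N1 where "\<And>i j. i \<ge> N1 \<Longrightarrow> j \<ge> N1 \<Longrightarrow> (LINT x|M. (g i x - g j x)\<^sup>2) < 1"
    using cauchy[of 1] by auto
  then have "L2_function M (\<lambda>x. g N1 x - g' x)" using fatou[of 1 N1 N1] by auto
  from L2_function_diff[OF g[of N1] this] have L2: "L2_function M g'" by simp
  have "(\<lambda>n. LINT x|M. (g n x - g' x)\<^sup>2) \<longlonglongrightarrow> 0"
  proof (rule LIMSEQ_I)
    fix e :: real assume e: "e > 0"
    obtain N where "\<And>i j. i \<ge> N \<Longrightarrow> j \<ge> N \<Longrightarrow> (LINT x|M. (g i x - g j x)\<^sup>2) < e / 2"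
      using cauchy[of "e / 2"] e by auto
    then have "(LINT x|M. (g n x - g' x)\<^sup>2) \<le> e / 2" if "n \<ge> N" for n
      using fatou[of "e / 2" N n] e that by auto
    then show "\<exists>N. \<forall>n\<ge>N. norm ((LINT x|M. (g n x - g' x)\<^sup>2) - 0) < e"
      using e by (intro exI[of _ N]) (fastforce intro: le_less_trans)
  qed
  with L2 show ?thesis by (rule that)
qed

subsection \<open>The interval as a measure space\<close>

text \<open>Restricting the space turns set integrals over an edge into plain integrals on a finite
  measure space, where the preceding L2 facts apply.\<close>

abbreviation interval_measure :: "real \<Rightarrow> real measure" where
  "interval_measure L \<equiv> restrict_space lborel {0<..<L}"

lemma space_interval_measure [simp]: "space (interval_measure L) = {0<..<L}"
  by (simp add: space_restrict_space)

lemma measure_interval_measure: "0 \<le> L \<Longrightarrow> measure (interval_measure L) {0<..<L} = L"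
  by (simp add: measure_restrict_space)

lemma finite_measure_interval_measure [simp]: "finite_measure (interval_measure L)"
proof (cases "0 \<le> L")
  case True
  then show ?thesis
    by (intro finite_measureI) (simp add: emeasure_restrict_space)
qed (auto intro!: finite_measureI simp: emeasure_restrict_space)

lemma set_integral_interval: "(LBINT t:{0<..<L}. f t) = (LINT t|interval_measure L. f t)"
  for f :: "real \<Rightarrow> real"
  by (simp add: set_lebesgue_integral_def integral_restrict_space)

lemma square_integrable_interval:
  "square_integrable {0<..<L} f \<longleftrightarrow> L2_function (interval_measure L) f"
  by (simp add: square_integrable_def L2_function_def set_borel_measurable_def set_integrable_def
      borel_measurable_restrict_space_iff integrable_restrict_space)

lemma continuous_imp_L2_function:
  assumes "continuous_on {0..L} f"
  shows "L2_function (interval_measure L) f"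
proof -
  have "continuous_on {0<..<L} f" using assms by (rule continuous_on_subset) auto
  then have "(\<lambda>x. indicator {0<..<L} x *\<^sub>R f x) \<in> borel_measurable lborel"
    using borel_measurable_continuous_on_indicator[of "{0<..<L}" f] by simp
  then have m: "f \<in> borel_measurable (interval_measure L)"
    by (simp add: borel_measurable_restrict_space_iff)
  have "bounded (f ` {0..L})"
    using assms by (intro compact_imp_bounded compact_continuous_image) auto
  then obtain B where "\<forall>x\<in>{0..L}. \<bar>f x\<bar> \<le> B"
    by (auto simp: bounded_iff)
  then show ?thesis
    using m by (intro L2_function_bounded[where B=B]) auto
qed

lemma integral_interval_FTC:
  assumes "0 \<le> L" and "\<And>x. (F has_real_derivative f x) (at x)" and "continuous_on UNIV f"
  shows "(LINT t|interval_measure L. f t) = F L - F 0"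
proof -
  have "(LBINT t=ereal 0..ereal L. f t) = F L - F 0"
    using assms
    by (intro interval_integral_FTC_finite)
      (auto intro: continuous_on_subset has_field_derivative_at_within
        simp flip: has_real_derivative_iff_has_vector_derivative)
  moreover have "(LBINT t=ereal 0..ereal L. f t) = (LBINT t:{0<..<L}. f t)"
    using interval_integral_Ioo[of "ereal 0" "ereal L" f] assms(1) by simp
  ultimately show ?thesis by (simp add: set_integral_interval)
qed

subsection \<open>Smooth steps\<close>

text \<open>The antiderivative of \<open>tent\<close>, which is the hat on \<open>[0, 1]\<close> of
  height 2 and mass 1. Piecewise quadratics suffice, as test functions are only required to be
  C1.\<close>

definition smoothstep :: "real \<Rightarrow> real" where
  "smoothstep x = 2 * (max 0 x)\<^sup>2 - 4 * (max 0 (x - 1/2))\<^sup>2 + 2 * (max 0 (x - 1))\<^sup>2"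

definition tent :: "real \<Rightarrow> real" where
  "tent x = 4 * max 0 x - 8 * max 0 (x - 1/2) + 4 * max 0 (x - 1)"

lemma has_real_derivative_max_0_square:
  "((\<lambda>x. (max 0 x)\<^sup>2) has_real_derivative 2 * max 0 x) (at x)"
proof (cases x "0 :: real" rule: linorder_cases)
  case less
  have "((\<lambda>x. 0) has_real_derivative 0) (at x)" by simp
  then have "((\<lambda>x. (max 0 x)\<^sup>2) has_real_derivative 0) (at x)"
    by (rule has_field_derivative_transform_within_open[of _ _ _ "{..<0}"]) (use less in auto)
  then show ?thesis using less by simp
next
  case greater
  have "((\<lambda>x. x\<^sup>2) has_real_derivative 2 * x) (at x)"
    by (auto intro!: derivative_eq_intros)
  then have "((\<lambda>x. (max 0 x)\<^sup>2) has_real_derivative 2 * x) (at x)"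
    by (rule has_field_derivative_transform_within_open[of _ _ _ "{0<..}"]) (use greater in auto)
  then show ?thesis using greater by simp
next
  case equal
  have "((\<lambda>h::real. (max 0 h)\<^sup>2 / h) \<longlongrightarrow> 0) (at 0)"
  proof (rule Lim_null_comparison)
    show "\<forall>\<^sub>F h::real in at 0. norm ((max 0 h)\<^sup>2 / h) \<le> \<bar>h\<bar>"
      by (intro always_eventually) (auto simp: max_def power2_eq_square)
    show "((\<lambda>h::real. \<bar>h\<bar>) \<longlongrightarrow> 0) (at 0)"
      by (intro tendsto_rabs_zero tendsto_ident_at)
  qed
  then show ?thesis using equal by (simp add: DERIV_def)
qed

lemma smoothstep_has_derivative: "(smoothstep has_real_derivative tent x) (at x)"
proof -
  have d: "((\<lambda>x. (max 0 (x - c))\<^sup>2) has_real_derivative 2 * max 0 (x - c)) (at x)" for c :: real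
  proof -
    have "((\<lambda>x. x - c) has_real_derivative 1) (at x)"
      by (auto intro!: derivative_eq_intros)
    from DERIV_chain2[where f="\<lambda>x. (max 0 x)\<^sup>2" and g="\<lambda>x. x - c",
        OF has_real_derivative_max_0_square this]
    show ?thesis by simp
  qed
  show ?thesis
    unfolding smoothstep_def[abs_def] tent_def
    using DERIV_add[OF DERIV_diff[OF DERIV_cmult[OF d[of 0], of 2] DERIV_cmult[OF d[of "1/2"], of 4]]
        DERIV_cmult[OF d[of 1], of 2]] by simp
qed

lemma smoothstep_le_0: "x \<le> 0 \<Longrightarrow> smoothstep x = 0"
  by (simp add: smoothstep_def max_def)

lemma smoothstep_ge_1: "1 \<le> x \<Longrightarrow> smoothstep x = 1"
  by (simp add: smoothstep_def max_def power2_eq_square algebra_simps)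

lemma tent_outside: "x \<le> 0 \<or> 1 \<le> x \<Longrightarrow> tent x = 0"
  by (auto simp: tent_def max_def)

lemma tent_nonneg: "0 \<le> tent x"
  by (auto simp: tent_def max_def)

lemma continuous_on_tent [continuous_intros]:
  "continuous_on S f \<Longrightarrow> continuous_on S (\<lambda>x. tent (f x))"
  unfolding tent_def by (intro continuous_intros)

lemma smoothstep_bounds: "0 \<le> smoothstep x" "smoothstep x \<le> 1"
proof -
  have mono: "x \<le> y \<Longrightarrow> smoothstep x \<le> smoothstep y" for x y
    by (rule DERIV_nonneg_imp_nondecreasing)
      (auto intro!: exI[of _ "tent _"] smoothstep_has_derivative tent_nonneg)
  show "0 \<le> smoothstep x"
    using mono[of "min 0 x" x] by (simp add: smoothstep_le_0)
  show "smoothstep x \<le> 1"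
    using mono[of x "max 1 x"] by (simp add: smoothstep_ge_1)
qed

lemma scaled_smoothstep_has_derivative:
  "((\<lambda>x. smoothstep (n * (x - a))) has_real_derivative n * tent (n * (x - a))) (at x)"
proof -
  have "((\<lambda>x. n * (x - a)) has_real_derivative n) (at x)"
    by (auto intro!: derivative_eq_intros)
  from DERIV_chain2[where f=smoothstep and g="\<lambda>x. n * (x - a)", OF smoothstep_has_derivative this]
  show ?thesis by (simp add: mult.commute)
qed

text \<open>The scaled tent is a probability density carried by \<open>[a, a + 1 / n]\<close>, so
  the integral is an average of values of \<open>f\<close> within \<open>e\<close> of
  \<open>v\<close>.\<close>

lemma integral_scaled_tent:
  assumes n: "0 < n" and a: "0 \<le> a" "a + 1 / n \<le> L" and f: "continuous_on {0..L} f"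
    and e: "\<And>x. x \<in> {a..a + 1 / n} \<Longrightarrow> \<bar>f x - v\<bar> \<le> e"
  shows "\<bar>(LINT x|interval_measure L. f x * (n * tent (n * (x - a)))) - v\<bar> \<le> e"
proof -
  let ?M = "interval_measure L" and ?\<rho> = "\<lambda>x. n * tent (n * (x - a))"
  have L: "0 \<le> L" using n a by (smt (verit) divide_pos_pos)
  have cont: "continuous_on UNIV ?\<rho>" by (intro continuous_intros)
  \<comment> \<open>The mass is the full rise of the step from 0 to 1, because the window lies
    inside \<open>[0, L]\<close>.\<close>
  have "(LINT x|?M. ?\<rho> x) = smoothstep (n * (L - a)) - smoothstep (n * (0 - a))"
    using L cont by (intro integral_interval_FTC scaled_smoothstep_has_derivative)
  moreover have "n * (L - a) \<ge> 1" using n a by (simp add: field_simps)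
  moreover have "n * (0 - a) \<le> 0" using n a by simp
  ultimately have one: "(LINT x|?M. ?\<rho> x) = 1"
    by (simp only: smoothstep_le_0 smoothstep_ge_1)
  have L2: "L2_function ?M ?\<rho>" "L2_function ?M f"
    using cont f by (auto intro: continuous_imp_L2_function continuous_on_subset)
  have int\<rho>: "integrable ?M ?\<rho>"
    using L2_function_integrable[OF _ L2(1)] by simp
  have int: "integrable ?M (\<lambda>x. f x * ?\<rho> x)"
    by (rule L2_function_integrable_mult[OF L2(2,1)])
  have "(LINT x|?M. f x * ?\<rho> x) - v = (LINT x|?M. f x * ?\<rho> x) - (LINT x|?M. v * ?\<rho> x)"
    using one by simp
  also have "\<dots> = (LINT x|?M. f x * ?\<rho> x - v * ?\<rho> x)"
    using int int\<rho> by (intro Bochner_Integration.integral_diff[symmetric]) auto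
  also have "\<bar>\<dots>\<bar> \<le> (LINT x|?M. e * ?\<rho> x)"
  proof (rule order_trans[OF integral_abs_bound integral_mono])
    show "integrable ?M (\<lambda>x. \<bar>f x * ?\<rho> x - v * ?\<rho> x\<bar>)"
      using int int\<rho> by auto
    show "integrable ?M (\<lambda>x. e * ?\<rho> x)" using int\<rho> by auto
    fix x
    have \<rho>: "0 \<le> ?\<rho> x" using n tent_nonneg by simp
    show "\<bar>f x * ?\<rho> x - v * ?\<rho> x\<bar> \<le> e * ?\<rho> x"
    proof (cases "x \<in> {a..a + 1 / n}")
      case True
      have "\<bar>f x * ?\<rho> x - v * ?\<rho> x\<bar> = \<bar>f x - v\<bar> * ?\<rho> x"
        using \<rho> by (simp only: left_diff_distrib[symmetric] abs_mult[of "f x - v"] abs_of_nonneg)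
      then show ?thesis using mult_right_mono[OF e[OF True] \<rho>] by simp
    next
      case False
      then have "n * (x - a) \<le> 0 \<or> 1 \<le> n * (x - a)"
        using n by (auto simp: field_simps mult_le_0_iff)
      then show ?thesis by (simp add: tent_outside)
    qed
  qed
  also have "\<dots> = e" using one by simp
  finally show ?thesis .
qed

text \<open>Only the windows \<open>[a n, a n + 1 / n]\<close> have to fit into
  \<open>[0, L]\<close>, so the limit point \<open>r\<close> may be an endpoint.\<close>

lemma integral_scaled_tent_limit:
  assumes f: "continuous_on {0..L} f" and r: "r \<in> {0..L}" and a: "a \<longlonglongrightarrow> r"
    and b: "\<forall>\<^sub>F n in sequentially. 0 \<le> a n \<and> a n + 1 / real n \<le> L"
  shows "(\<lambda>n. LINT x|interval_measure L. f x * (real n * tent (real n * (x - a n)))) \<longlonglongrightarrow> f r"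
proof (rule LIMSEQ_I)
  fix e :: real assume e: "e > 0"
  obtain d where d: "d > 0" "\<And>x. x \<in> {0..L} \<Longrightarrow> dist x r < d \<Longrightarrow> dist (f x) (f r) < e / 2"
    using f r e unfolding continuous_on_iff by (meson half_gt_zero)
  have "\<forall>\<^sub>F n in sequentially. dist (a n) r < d / 2"
    using a d(1) by (intro tendstoD) auto
  moreover have "\<forall>\<^sub>F n in sequentially. dist (1 / real n) 0 < d / 2"
    using d(1) by (intro tendstoD[OF lim_1_over_n]) auto
  ultimately have "\<forall>\<^sub>F n in sequentially.
      norm ((LINT x|interval_measure L. f x * (real n * tent (real n * (x - a n)))) - f r) < e"
    using b eventually_gt_at_top[of 0]
  proof eventually_elim
    case (elim n)
    have "\<bar>(LINT x|interval_measure L. f x * (real n * tent (real n * (x - a n)))) - f r\<bar> \<le> e / 2"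
    proof (rule integral_scaled_tent)
      fix x assume x: "x \<in> {a n..a n + 1 / real n}"
      have "dist x r \<le> dist (a n) r + dist (1 / real n) 0"
        using x unfolding dist_real_def by auto
      then have "dist x r < d" using elim by simp
      then show "\<bar>f x - f r\<bar> \<le> e / 2"
        using d(2)[of x] x elim by (simp add: dist_real_def)
    qed (use elim f in auto)
    then show ?case using e by simp
  qed
  then show "\<exists>N. \<forall>n\<ge>N. norm ((LINT x|interval_measure L.
      f x * (real n * tent (real n * (x - a n)))) - f r) < e"
    by (simp add: eventually_sequentially)
qed

subsection \<open>Weak derivatives of continuous functions on an interval\<close>

text \<open>Test functions tending to the indicator of \<open>(s, t)\<close> whose derivatives concentrate at \<open>s\<close> and
  \<open>t\<close>. The shifts keep the support compact in \<open>(s, t)\<close>, so that \<open>s = 0\<close> and \<open>t = L\<close> are allowed in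
  the fundamental theorem below.\<close>

definition plateau :: "real \<Rightarrow> real \<Rightarrow> nat \<Rightarrow> real \<Rightarrow> real" where
  "plateau s t n x = smoothstep (real n * (x - (s + 1 / real n)))
    - smoothstep (real n * (x - (t - 2 / real n)))"

lemma plateau_has_derivative:
  "(plateau s t n has_real_derivative real n * tent (real n * (x - (s + 1 / real n)))
    - real n * tent (real n * (x - (t - 2 / real n)))) (at x)"
  unfolding plateau_def[abs_def] by (intro DERIV_diff scaled_smoothstep_has_derivative)

text \<open>The first step rises on \<open>[s + 1/n, s + 2/n]\<close>, the second on
  \<open>[t - 2/n, t - 1/n]\<close>. The bound 3 says \<open>s + 1/n \<le> t - 2/n\<close>: left of
  the first window both steps are 0, and right of the second both are 1 and cancel.\<close>

lemma plateau_outside: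
  assumes n: "0 < n" "3 \<le> real n * (t - s)" and x: "x \<notin> {s + 1 / real n..t - 1 / real n}"
  shows "plateau s t n x = 0"
proof (cases "x < s + 1 / real n")
  case True
  then have "real n * x < real n * s + 1" using n by (simp add: field_simps)
  then have "real n * (x - (s + 1 / real n)) \<le> 0" "real n * (x - (t - 2 / real n)) \<le> 0"
    using n by (auto simp: algebra_simps)
  then show ?thesis by (simp add: plateau_def smoothstep_le_0)
next
  case False
  with x have "x > t - 1 / real n" by auto
  then have "real n * x > real n * t - 1" using n by (simp add: field_simps)
  then have "real n * (x - (s + 1 / real n)) \<ge> 1" "real n * (x - (t - 2 / real n)) \<ge> 1"
    using n by (auto simp: algebra_simps)
  then show ?thesis by (simp add: plateau_def smoothstep_ge_1)
qed

lemma test_function_plateau: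
  assumes "0 \<le> s" "t \<le> L" and n: "0 < n" "3 \<le> real n * (t - s)"
  shows "test_function {0<..<L} (plateau s t n)"
proof -
  have "{x. plateau s t n x \<noteq> 0} \<subseteq> {s + 1 / real n..t - 1 / real n}"
    using plateau_outside[OF n] by blast
  then have cl: "closure {x. plateau s t n x \<noteq> 0} \<subseteq> {s + 1 / real n..t - 1 / real n}"
    by (rule closure_minimal) auto
  have "0 < 1 / real n" using n by simp
  have "{s + 1 / real n..t - 1 / real n} \<subseteq> {0<..<L}"
  proof
    fix x assume "x \<in> {s + 1 / real n..t - 1 / real n}"
    then have "s + 1 / real n \<le> x" "x \<le> t - 1 / real n" by auto
    with \<open>0 < 1 / real n\<close> have "0 < x" "x < L" using assms(1,2) by linarith+
    then show "x \<in> {0<..<L}" by simp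
  qed
  moreover have "compact (closure {x. plateau s t n x \<noteq> 0})"
    using cl by (metis bounded_closed_interval bounded_subset closed_closure compact_eq_bounded_closed)
  moreover have "plateau s t n C1_differentiable_on UNIV"
    unfolding C1_differentiable_on_def
    by (rule exI, intro conjI ballI)
      (rule plateau_has_derivative[unfolded has_real_derivative_iff_has_vector_derivative],
        intro continuous_intros)
  ultimately show ?thesis
    unfolding test_function_def using cl by blast
qed

text \<open>At each fixed \<open>x\<close> the sequence is eventually constant. Inside
  \<open>(s, t)\<close> the two bounds by 2 place \<open>x\<close> beyond the rise and before the
  fall; at \<open>s\<close> and \<open>t\<close> themselves the plateau vanishes, whence the open
  interval.\<close>

lemma plateau_limit:
  assumes "s < t"
  shows "(\<lambda>n. plateau s t n x) \<longlonglongrightarrow> indicator {s<..<t} x"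
proof -
  have ev: "\<forall>\<^sub>F n in sequentially. c \<le> real n * d" if "0 < d" for c d :: real
  proof -
    have "filterlim (\<lambda>n. real n * d) at_top sequentially"
      using that by (intro filterlim_at_top_mult_tendsto_pos[OF tendsto_const] filterlim_real_sequentially)
    then show ?thesis by (simp add: filterlim_at_top)
  qed
  have ts: "0 < t - s" using assms by simp
  have "\<forall>\<^sub>F n in sequentially. plateau s t n x = indicator {s<..<t} x"
  proof (cases "s < x \<and> x < t")
    case False
    show ?thesis
      using ev[OF ts, of 3] eventually_gt_at_top[of 0]
    proof eventually_elim
      case (elim n)
      then have "0 < 1 / real n" by simp
      then have "\<not> (s + 1 / real n \<le> x \<and> x \<le> t - 1 / real n)" using False by linarith
      then have "x \<notin> {s + 1 / real n..t - 1 / real n}" by simp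
      then show ?case using plateau_outside[OF elim(2,1)] False by simp
    qed
  next
    case True
    then have "0 < x - s" "0 < t - x" by auto
    from ev[OF this(1), of 2] ev[OF this(2), of 2] eventually_gt_at_top[of 0] show ?thesis
    proof eventually_elim
      case (elim n)
      then have "real n * (x - (s + 1 / real n)) \<ge> 1" "real n * (x - (t - 2 / real n)) \<le> 0"
        by (auto simp: algebra_simps)
      then show ?case using True by (simp add: plateau_def smoothstep_ge_1 smoothstep_le_0)
    qed
  qed
  then show ?thesis by (rule tendsto_eventually)
qed

lemma weak_derivative_interval:
  "weak_derivative {0<..<L} f g \<longleftrightarrow> (\<forall>\<phi>. test_function {0<..<L} \<phi> \<longrightarrow>
    (LINT t|interval_measure L. f t * deriv \<phi> t) = - (LINT t|interval_measure L. g t * \<phi> t))"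
  by (simp add: weak_derivative_def set_integral_interval)

lemma L2_function_indicator: "L2_function (interval_measure L) (indicator {s<..<t})"
proof -
  have "(indicator {s<..<t} :: real \<Rightarrow> real) \<in> borel_measurable (interval_measure L)"
    by (intro measurable_restrict_space1) simp
  then show ?thesis
    by (rule L2_function_bounded[OF finite_measure_interval_measure, where B=1]) (simp add: indicator_def)
qed

text \<open>The fundamental theorem for weak derivatives. In the weak identity tested with plateaus,
  the derivative of the plateau is a difference of two concentrating tents, so one side tends to
  \<open>f s - f t\<close>; dominated convergence with bound \<open>\<bar>g\<bar>\<close> gives
  minus the integral of \<open>g\<close> over \<open>(s, t)\<close> on the other.\<close>

lemma weak_derivative_imp_integral:
  assumes f: "continuous_on {0..L} f" and g: "L2_function (interval_measure L) g"
    and w: "weak_derivative {0<..<L} f g" and st: "0 \<le> s" "s < t" "t \<le> L"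
  shows "f t - f s = (LINT x|interval_measure L. indicator {s<..<t} x * g x)"
proof -
  let ?M = "interval_measure L"
  have M: "finite_measure ?M" by simp
  \<comment> \<open>Left ends of the two windows of length \<open>1 / n\<close> in which the plateau
    rises and falls.\<close>
  define a b where "a n = s + 1 / real n" and "b n = t - 2 / real n" for n
  let ?\<rho> = "\<lambda>a n x. real n * tent (real n * (x - a n))"
  have big: "\<forall>\<^sub>F n in sequentially. 3 \<le> real n * (t - s)"
  proof -
    have "filterlim (\<lambda>n. real n * (t - s)) at_top sequentially"
      using st by (intro filterlim_at_top_mult_tendsto_pos[OF tendsto_const] filterlim_real_sequentially) auto
    then show ?thesis by (simp add: filterlim_at_top)
  qed
  have ab: "\<forall>\<^sub>F n in sequentially. (0 \<le> a n \<and> a n + 1 / real n \<le> L) \<and> (0 \<le> b n \<and> b n + 1 / real n \<le> L)"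
    using big eventually_gt_at_top[of 0]
  proof eventually_elim
    case (elim n)
    then have "3 * (1 / real n) \<le> t - s" "0 < 1 / real n" "2 / real n = 2 * (1 / real n)"
      by (auto simp: field_simps)
    then show ?case using st unfolding a_def b_def by linarith
  qed
  have "(\<lambda>n. s + 1 * (1 / real n)) \<longlonglongrightarrow> s + 1 * 0" "(\<lambda>n. t - 2 * (1 / real n)) \<longlonglongrightarrow> t - 2 * 0"
    by (intro tendsto_intros lim_1_over_n)+
  then have lims: "a \<longlonglongrightarrow> s" "b \<longlonglongrightarrow> t"
    by (auto simp: a_def[abs_def] b_def[abs_def])
  have "(\<lambda>n. LINT x|?M. f x * ?\<rho> a n x) \<longlonglongrightarrow> f s"
    using st ab by (intro integral_scaled_tent_limit[OF f _ lims(1)]) (auto elim: eventually_mono)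
  moreover have "(\<lambda>n. LINT x|?M. f x * ?\<rho> b n x) \<longlonglongrightarrow> f t"
    using st ab by (intro integral_scaled_tent_limit[OF f _ lims(2)]) (auto elim: eventually_mono)
  ultimately have lhs: "(\<lambda>n. (LINT x|?M. f x * ?\<rho> a n x) - (LINT x|?M. f x * ?\<rho> b n x)) \<longlonglongrightarrow> f s - f t"
    by (rule tendsto_diff)
  have gi: "integrable ?M g" using g by (intro L2_function_integrable) auto
  have "(\<lambda>n. LINT x|?M. g x * plateau s t n x) \<longlonglongrightarrow> (LINT x|?M. g x * indicator {s<..<t} x)"
  proof (rule integral_dominated_convergence[where w="\<lambda>x. \<bar>g x\<bar>"])
    have pm: "continuous_on UNIV (plateau s t n)" for n
      using plateau_has_derivative DERIV_isCont by (metis continuous_at_imp_continuous_on)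
    show "(\<lambda>x. g x * plateau s t n x) \<in> borel_measurable ?M" for n
      using L2_function_integrable_mult[OF g continuous_imp_L2_function]
        continuous_on_subset[OF pm] by (meson borel_measurable_integrable top_greatest)
    show "(\<lambda>x. g x * indicator {s<..<t} x) \<in> borel_measurable ?M"
      using g L2_function_indicator[of L s t] by (auto simp: L2_function_def)
    show "AE x in ?M. norm (g x * plateau s t n x) \<le> \<bar>g x\<bar>" for n
    proof (rule AE_I2)
      fix x
      have "\<bar>plateau s t n x\<bar> \<le> 1"
        unfolding plateau_def using smoothstep_bounds by (smt (verit))
      then show "norm (g x * plateau s t n x) \<le> \<bar>g x\<bar>"
        by (simp add: abs_mult mult_left_le)
    qed
    show "AE x in ?M. (\<lambda>n. g x * plateau s t n x) \<longlonglongrightarrow> g x * indicator {s<..<t} x"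
      using plateau_limit[OF st(2)] by (intro AE_I2 tendsto_mult_left)
    show "integrable ?M (\<lambda>x. \<bar>g x\<bar>)" using gi by simp
  qed
  then have rhs: "(\<lambda>n. - (LINT x|?M. g x * plateau s t n x)) \<longlonglongrightarrow> - (LINT x|?M. g x * indicator {s<..<t} x)"
    by (rule tendsto_minus)
  have "\<forall>\<^sub>F n in sequentially. (LINT x|?M. f x * ?\<rho> a n x) - (LINT x|?M. f x * ?\<rho> b n x)
      = - (LINT x|?M. g x * plateau s t n x)"
    using big eventually_gt_at_top[of 0]
  proof eventually_elim
    case (elim n)
    have d: "deriv (plateau s t n) x = ?\<rho> a n x - ?\<rho> b n x" for x
      unfolding a_def b_def by (rule DERIV_imp_deriv[OF plateau_has_derivative])
    have "(LINT x|?M. f x * deriv (plateau s t n) x) = - (LINT x|?M. g x * plateau s t n x)"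
      using w test_function_plateau[OF st(1,3) elim(2,1)]
      unfolding weak_derivative_interval by blast
    then have "(LINT x|?M. f x * (?\<rho> a n x - ?\<rho> b n x)) = - (LINT x|?M. g x * plateau s t n x)"
      unfolding d .
    moreover have "L2_function ?M (?\<rho> a n)" "L2_function ?M (?\<rho> b n)"
      by (intro continuous_imp_L2_function continuous_intros)+
    ultimately show ?case
      using L2_function_integrable_mult[OF continuous_imp_L2_function[OF f]]
      by (simp add: right_diff_distrib)
  qed
  then have "(\<lambda>n. - (LINT x|?M. g x * plateau s t n x)) \<longlonglongrightarrow> f s - f t"
    using lhs tendsto_cong by fast
  from LIMSEQ_unique[OF rhs this] show ?thesis by (simp add: mult.commute)
qed

text \<open>Dynkin's theorem: open intervals are stable under intersection and generate the Borel
  sets, and the sets over which \<open>h\<close> integrates to 0 are closed under complement and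
  countable disjoint union. A function with zero integral over every measurable set vanishes almost
  everywhere.\<close>

lemma interval_measure_AE_zero:
  fixes h :: "real \<Rightarrow> real"
  assumes h: "integrable (interval_measure L) h" and L: "0 < L"
    and zero: "\<And>s t. 0 \<le> s \<Longrightarrow> s < t \<Longrightarrow> t \<le> L \<Longrightarrow>
      (LINT x|interval_measure L. indicator {s<..<t} x * h x) = 0"
  shows "AE x in interval_measure L. h x = 0"
proof -
  let ?M = "interval_measure L"
  interpret finite_measure ?M by simp
  have sets_M: "B \<inter> {0<..<L} \<in> sets ?M" if "B \<in> sets borel" for B
    using that by (auto simp: sets_restrict_space)
  \<comment> \<open>Only the trace on \<open>(0, L)\<close> matters. This allows the induction to
    run over Borel sets of the line and intervals that stick out to be clipped.\<close>
  have restr: "(LINT x|?M. indicator B x * h x) = (LINT x|?M. indicator C x * h x)"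
    if "B \<inter> {0<..<L} = C \<inter> {0<..<L}" for B C
  proof (rule Bochner_Integration.integral_cong)
    fix x assume x: "x \<in> space ?M"
    have "x \<in> B \<inter> {0<..<L} \<longleftrightarrow> x \<in> C \<inter> {0<..<L}" by (simp only: that)
    then have "x \<in> B \<longleftrightarrow> x \<in> C" using x by simp
    then show "indicator B x * h x = indicator C x * h x" by (simp add: indicator_def)
  qed simp
  have int: "integrable ?M (\<lambda>x. indicator B x * h x)" if "B \<in> sets borel" for B
  proof -
    have "integrable ?M (\<lambda>x. indicator (B \<inter> {0<..<L}) x *\<^sub>R h x)"
      by (rule integrable_mult_indicator[OF sets_M[OF that] h])
    then show ?thesis
      by (rule Bochner_Integration.integrable_cong[THEN iffD1, rotated 2]) (auto simp: indicator_def)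
  qed
  \<comment> \<open>Needed for complements: the integral over \<open>UNIV - A\<close> is the total
    minus the integral over \<open>A\<close>.\<close>
  have total: "(LINT x|?M. h x) = 0"
  proof -
    have "(LINT x|?M. h x) = (LINT x|?M. indicator {0<..<L} x * h x)"
      by (rule Bochner_Integration.integral_cong) auto
    then show ?thesis using zero[of 0 L] L by simp
  qed
  have borel: "borel = sigma UNIV (range (\<lambda>(a, b). {a<..<b :: real}))"
    using borel_eq_box[where 'a=real] by simp
  have *: "(LINT x|?M. indicator B x * h x) = 0" if B: "B \<in> sets borel" for B
  proof -
    have "Int_stable (range (\<lambda>(a, b). {a<..<b :: real}))"
    proof (rule Int_stableI)
      fix A B assume "A \<in> range (\<lambda>(a, b). {a<..<b :: real})" "B \<in> range (\<lambda>(a, b). {a<..<b :: real})"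
      then obtain a b c d where "A = {a<..<b}" "B = {c<..<d}" by auto
      then have "A \<inter> B = {max a c<..<min b d}" by auto
      then show "A \<inter> B \<in> range (\<lambda>(a, b). {a<..<b :: real})"
        by (intro image_eqI[of _ _ "(max a c, min b d)"]) auto
    qed
    moreover have "range (\<lambda>(a, b). {a<..<b :: real}) \<subseteq> Pow UNIV" by simp
    moreover have "B \<in> sigma_sets UNIV (range (\<lambda>(a, b). {a<..<b :: real}))"
      using B unfolding borel by simp
    ultimately show ?thesis
    proof (induction rule: sigma_sets_induct_disjoint)
      case (basic A)
      then obtain a b where A: "A = {a<..<b}" by auto
      define s t where "s = max 0 a" and "t = min L b"
      have eq: "A \<inter> {0<..<L} = {s<..<t}" "A \<inter> {0<..<L} = {s<..<t} \<inter> {0<..<L}"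
        unfolding A s_def t_def using L by auto
      show ?case
      proof (cases "s < t")
        case True
        then show ?thesis
          unfolding restr[OF eq(2)] by (intro zero) (auto simp: s_def t_def)
      next
        case False
        then show ?thesis using restr[of A "{}"] eq by simp
      qed
    next
      case (compl A)
      then have A: "A \<in> sets borel" unfolding borel by simp
      have "(LINT x|?M. indicator (UNIV - A) x * h x) = (LINT x|?M. h x - indicator A x * h x)"
        by (rule Bochner_Integration.integral_cong) (auto simp: indicator_def)
      also have "\<dots> = 0"
        using h int[OF A] total compl by simp
      finally show ?case .
    next
      case (union A)
      then have A: "A i \<in> sets borel" for i unfolding borel by auto
      let ?A = "\<lambda>i. A i \<inter> {0<..<L}"
      have UN: "(\<Union>i. A i) \<inter> {0<..<L} = (\<Union>i. ?A i) \<inter> {0<..<L}" by auto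
      have "(LINT x:(\<Union>i. ?A i)|?M. h x) = (\<Sum>i. (LINT x:?A i|?M. h x))"
      proof (rule lebesgue_integral_countable_add)
        show "set_integrable ?M (\<Union>i. ?A i) h"
          unfolding set_integrable_def
          by (intro integrable_mult_indicator[OF _ h] sets.countable_UN) (use sets_M[OF A] in auto)
      qed (use sets_M[OF A] union(1) in \<open>auto simp: disjoint_family_on_def\<close>)
      also have "\<dots> = (\<Sum>i. LINT x|?M. indicator (A i) x * h x)"
        using restr[of "A _" "?A _"] by (simp add: set_lebesgue_integral_def)
      also have "\<dots> = 0" by (simp add: union(3))
      finally show ?case
        unfolding restr[OF UN] by (simp add: set_lebesgue_integral_def)
    qed simp
  qed
  show ?thesis
  proof (rule density_zero[OF h])
    fix A assume "A \<in> sets ?M"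
    then have "A \<in> sets borel" by (auto simp: sets_restrict_space)
    then show "(LINT x:A|?M. h x) = 0" using * by (simp add: set_lebesgue_integral_def)
  qed
qed

text \<open>Both weak derivatives have integral \<open>f t - f s\<close> over every
  \<open>(s, t)\<close>, so their difference integrates to 0 over all intervals.\<close>

lemma weak_derivative_unique:
  assumes L: "0 < L" and f: "continuous_on {0..L} f"
    and g: "L2_function (interval_measure L) g" "weak_derivative {0<..<L} f g"
    and g': "L2_function (interval_measure L) g'" "weak_derivative {0<..<L} f g'"
  shows "AE x in interval_measure L. g x = g' x"
proof -
  let ?M = "interval_measure L"
  have "AE x in ?M. g x - g' x = 0"
  proof (rule interval_measure_AE_zero[OF _ L])
    show "integrable ?M (\<lambda>x. g x - g' x)"
      using L2_function_integrable[OF _ L2_function_diff[OF g(1) g'(1)]] by simp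
    fix s t assume st: "0 \<le> s" "s < t" "t \<le> L"
    have ind: "L2_function ?M (indicator {s<..<t})"
      by (rule L2_function_indicator)
    show "(LINT x|?M. indicator {s<..<t} x * (g x - g' x)) = 0"
      using weak_derivative_imp_integral[OF f g st] weak_derivative_imp_integral[OF f g' st]
        L2_function_integrable_mult[OF ind g(1)] L2_function_integrable_mult[OF ind g'(1)]
      by (simp add: right_diff_distrib)
  qed
  then show ?thesis by simp
qed

lemma test_function_derivative:
  assumes "test_function J \<phi>"
  shows "(\<phi> has_real_derivative deriv \<phi> x) (at x)"
    and "continuous_on S \<phi>" and "continuous_on S (deriv \<phi>)"
    and "x \<notin> J \<Longrightarrow> \<phi> x = 0"
proof -
  obtain D where D: "\<And>x. (\<phi> has_real_derivative D x) (at x)" "continuous_on UNIV D"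
    using assms
    by (auto simp: test_function_def C1_differentiable_on_def has_real_derivative_iff_has_vector_derivative)
  have eq: "deriv \<phi> = D" using D(1) by (auto intro: DERIV_imp_deriv)
  show "(\<phi> has_real_derivative deriv \<phi> x) (at x)" using D(1) eq by simp
  show "continuous_on S \<phi>"
    using D(1) DERIV_isCont by (metis continuous_at_imp_continuous_on)
  show "continuous_on S (deriv \<phi>)" using D(2) eq by (auto intro: continuous_on_subset)
  show "\<phi> x = 0" if "x \<notin> J"
    using assms that closure_subset[of "{t. \<phi> t \<noteq> 0}"] by (auto simp: test_function_def)
qed

text \<open>Integration by parts; the boundary terms vanish because \<open>0\<close> and
  \<open>L\<close> lie outside the open interval that carries the test function. This serves the
  explicit bump that makes \<open>H10_nonzero\<close> nonempty.\<close>

lemma classical_imp_weak_derivative: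
  assumes L: "0 \<le> L" and f: "\<And>x. (f has_real_derivative f' x) (at x)" "continuous_on UNIV f'"
  shows "weak_derivative {0<..<L} f f'"
  unfolding weak_derivative_interval
proof (intro allI impI)
  fix \<phi> assume \<phi>: "test_function {0<..<L} \<phi>"
  let ?M = "interval_measure L"
  note d = test_function_derivative[OF \<phi>]
  have cf: "continuous_on S f" for S
    using f(1) DERIV_isCont by (metis continuous_at_imp_continuous_on)
  have "(LINT t|?M. f t * deriv \<phi> t + f' t * \<phi> t) = f L * \<phi> L - f 0 * \<phi> 0"
  proof (rule integral_interval_FTC[OF L])
    show "((\<lambda>x. f x * \<phi> x) has_real_derivative f x * deriv \<phi> x + f' x * \<phi> x) (at x)" for x
      using DERIV_mult[OF f(1)[of x] d(1)[of x]] by (simp add: algebra_simps)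
    show "continuous_on UNIV (\<lambda>x. f x * deriv \<phi> x + f' x * \<phi> x)"
      using f(2) cf d(2,3) by (intro continuous_intros)
  qed
  also have "\<dots> = 0" by (simp add: d(4))
  also have "(LINT t|?M. f t * deriv \<phi> t + f' t * \<phi> t)
      = (LINT t|?M. f t * deriv \<phi> t) + (LINT t|?M. f' t * \<phi> t)"
    using cf d(2,3) continuous_on_subset[OF f(2)]
    by (intro Bochner_Integration.integral_add L2_function_integrable_mult continuous_imp_L2_function) auto
  finally show "(LINT t|?M. f t * deriv \<phi> t) = - (LINT t|?M. f' t * \<phi> t)" by simp
qed

lemma weak_derivative_linear:
  assumes "L2_function (interval_measure L) f" "L2_function (interval_measure L) g"
    and "L2_function (interval_measure L) f'" "L2_function (interval_measure L) g'"
    and "weak_derivative {0<..<L} f f'" "weak_derivative {0<..<L} g g'"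
  shows "weak_derivative {0<..<L} (\<lambda>t. a * f t + b * g t) (\<lambda>t. a * f' t + b * g' t)"
  unfolding weak_derivative_interval
proof (intro allI impI)
  fix \<phi> assume \<phi>: "test_function {0<..<L} \<phi>"
  let ?M = "interval_measure L"
  have \<phi>2: "L2_function ?M \<phi>" "L2_function ?M (deriv \<phi>)"
    using test_function_derivative[OF \<phi>] by (auto intro: continuous_imp_L2_function)
  have lin: "(LINT t|?M. (a * u t + b * v t) * w t) = a * (LINT t|?M. u t * w t) + b * (LINT t|?M. v t * w t)"
    if "L2_function ?M u" "L2_function ?M v" "L2_function ?M w" for u v w
    using L2_function_integrable_mult[OF that(1,3)] L2_function_integrable_mult[OF that(2,3)]
    by (simp add: distrib_right mult.assoc)
  show "(LINT t|?M. (a * f t + b * g t) * deriv \<phi> t) = - (LINT t|?M. (a * f' t + b * g' t) * \<phi> t)"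
    using assms \<phi> \<phi>2 by (simp add: lin weak_derivative_interval)
qed

text \<open>Both sides of the weak identity pair a sequence with a fixed L2 function, the test
  function or its derivative, so L2 convergence passes to the limit. For \<open>f n\<close> it
  follows from uniform convergence on an interval of finite length.\<close>

lemma weak_derivative_limit:
  assumes f: "\<And>n. continuous_on {0..L} (f n)" "continuous_on {0..L} f'"
    and unif: "\<And>e. e > 0 \<Longrightarrow> \<exists>N. \<forall>n\<ge>N. \<forall>x\<in>{0..L}. \<bar>f n x - f' x\<bar> < e"
    and g: "\<And>n. L2_function (interval_measure L) (g n)" "L2_function (interval_measure L) g'"
    and lim: "(\<lambda>n. LINT x|interval_measure L. (g n x - g' x)\<^sup>2) \<longlonglongrightarrow> 0"
    and w: "\<And>n. weak_derivative {0<..<L} (f n) (g n)"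
    and L: "0 < L"
  shows "(\<lambda>n. LINT x|interval_measure L. (f n x - f' x)\<^sup>2) \<longlonglongrightarrow> 0"
    and "weak_derivative {0<..<L} f' g'"
proof -
  let ?M = "interval_measure L"
  interpret finite_measure ?M by simp
  note f2 = continuous_imp_L2_function[OF f(1)] continuous_imp_L2_function[OF f(2)]
  show limf: "(\<lambda>n. LINT x|?M. (f n x - f' x)\<^sup>2) \<longlonglongrightarrow> 0"
  proof (rule LIMSEQ_I)
    fix e :: real assume e: "e > 0"
    \<comment> \<open>Chosen so that a function bounded by \<open>d\<close> has squared L2 norm at
      most \<open>e / 2\<close>.\<close>
    define d where "d = sqrt (e / (2 * L))"
    have d: "d > 0" "d\<^sup>2 * L = e / 2" using e L by (auto simp: d_def)
    obtain N where N: "\<And>n x. n \<ge> N \<Longrightarrow> x \<in> {0..L} \<Longrightarrow> \<bar>f n x - f' x\<bar> < d"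
      using unif[OF d(1)] by blast
    have "norm ((LINT x|?M. (f n x - f' x)\<^sup>2) - 0) < e" if "n \<ge> N" for n
    proof -
      have "(LINT x|?M. (f n x - f' x)\<^sup>2) \<le> (LINT x|?M. d\<^sup>2)"
      proof (rule integral_mono)
        show "integrable ?M (\<lambda>x. (f n x - f' x)\<^sup>2)"
          by (rule L2_function_integrable_square[OF L2_function_diff[OF f2]])
        fix x assume "x \<in> space ?M"
        then have "\<bar>f n x - f' x\<bar>\<^sup>2 \<le> d\<^sup>2"
          using N[OF that, of x] by (intro power_mono) auto
        then show "(f n x - f' x)\<^sup>2 \<le> d\<^sup>2" by simp
      qed simp
      also have "\<dots> = e / 2" using L d by (simp add: measure_interval_measure mult.commute)
      finally show ?thesis using e by simp
    qed
    then show "\<exists>N. \<forall>n\<ge>N. norm ((LINT x|?M. (f n x - f' x)\<^sup>2) - 0) < e" by blast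
  qed
  show "weak_derivative {0<..<L} f' g'"
    unfolding weak_derivative_interval
  proof (intro allI impI)
    fix \<phi> assume \<phi>: "test_function {0<..<L} \<phi>"
    have \<phi>2: "L2_function ?M \<phi>" "L2_function ?M (deriv \<phi>)"
      using test_function_derivative[OF \<phi>] by (auto intro: continuous_imp_L2_function)
    have "(\<lambda>n. LINT x|?M. f n x * deriv \<phi> x) \<longlonglongrightarrow> (LINT x|?M. f' x * deriv \<phi> x)"
      by (rule L2_limit_integral_mult[OF f2 \<phi>2(2) limf])
    moreover have "(\<lambda>n. - (LINT x|?M. g n x * \<phi> x)) \<longlonglongrightarrow> - (LINT x|?M. g' x * \<phi> x)"
      by (intro tendsto_minus L2_limit_integral_mult[OF g \<phi>2(1) lim])
    moreover have "(LINT x|?M. f n x * deriv \<phi> x) = - (LINT x|?M. g n x * \<phi> x)" for n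
      using w \<phi> by (simp add: weak_derivative_interval)
    ultimately show "(LINT x|?M. f' x * deriv \<phi> x) = - (LINT x|?M. g' x * \<phi> x)"
      by (simp add: LIMSEQ_unique)
  qed
qed

subsection \<open>The Sobolev space of an interval\<close>

text \<open>\<open>H1_interval\<close> restricts a function only up to null sets of the open
  interval. Continuity on the closed interval selects the good representative and gives the endpoint
  values a meaning.\<close>

definition continuous_H1 :: "real \<Rightarrow> (real \<Rightarrow> real) set" where
  "continuous_H1 L = {f \<in> H1_interval {0<..<L}. continuous_on {0..L} f}"

definition interval_energy :: "real \<Rightarrow> (real \<Rightarrow> real) \<Rightarrow> real" where
  "interval_energy L f = (LBINT t:{0<..<L}. \<bar>wderiv {0<..<L} f t\<bar>\<^sup>2 + \<bar>f t\<bar>\<^sup>2)"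

lemma H1_interval_iff:
  "f \<in> H1_interval {0<..<L} \<longleftrightarrow> L2_function (interval_measure L) f \<and>
    (\<exists>g. L2_function (interval_measure L) g \<and> weak_derivative {0<..<L} f g)"
  by (auto simp: H1_interval_def square_integrable_interval)

text \<open>The \<open>SOME\<close> in \<open>wderiv\<close> becomes harmless: its choice agrees
  almost everywhere with any weak derivative at hand. Later energy computations go through this
  identity.\<close>

lemma interval_energy_eq:
  assumes L: "0 < L" and f: "continuous_on {0..L} f"
    and g: "L2_function (interval_measure L) g" "weak_derivative {0<..<L} f g"
  shows "interval_energy L f
    = (LINT t|interval_measure L. (g t)\<^sup>2) + (LINT t|interval_measure L. (f t)\<^sup>2)"
proof -
  let ?M = "interval_measure L" and ?g = "wderiv {0<..<L} f"
  have "L2_function ?M ?g \<and> weak_derivative {0<..<L} f ?g"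
    unfolding wderiv_def square_integrable_interval using g by (intro someI_ex[of "\<lambda>g. L2_function _ g \<and> _ g"]) blast
  then have g': "L2_function ?M ?g" "weak_derivative {0<..<L} f ?g" by auto
  have f2: "L2_function ?M f" using f by (rule continuous_imp_L2_function)
  have "interval_energy L f = (LINT t|?M. (?g t)\<^sup>2) + (LINT t|?M. (f t)\<^sup>2)"
    using L2_function_integrable_square[OF g'(1)] L2_function_integrable_square[OF f2]
    by (simp add: interval_energy_def set_integral_interval)
  also have "(LINT t|?M. (?g t)\<^sup>2) = (LINT t|?M. (g t)\<^sup>2)"
  proof (rule integral_cong_AE)
    show "AE t in ?M. (?g t)\<^sup>2 = (g t)\<^sup>2"
      using weak_derivative_unique[OF L f g' g] by eventually_elim simp
  qed (use g g' in \<open>auto simp: L2_function_def\<close>)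
  finally show ?thesis .
qed

context
  fixes L :: real
  assumes L: "0 < L"
begin

lemma continuous_H1E:
  assumes "f \<in> continuous_H1 L"
  obtains g where "continuous_on {0..L} f" "L2_function (interval_measure L) f"
    "L2_function (interval_measure L) g" "weak_derivative {0<..<L} f g"
    "interval_energy L f = (LINT t|interval_measure L. (g t)\<^sup>2) + (LINT t|interval_measure L. (f t)\<^sup>2)"
  using assms interval_energy_eq[OF L] unfolding continuous_H1_def H1_interval_iff by blast

lemma continuous_H1_linear:
  assumes "f \<in> continuous_H1 L" and "g \<in> continuous_H1 L"
  shows "(\<lambda>t. a * f t + b * g t) \<in> continuous_H1 L"
proof -
  obtain f' where f: "continuous_on {0..L} f" "L2_function (interval_measure L) f"
    "L2_function (interval_measure L) f'" "weak_derivative {0<..<L} f f'"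
    using assms(1) by (rule continuous_H1E)
  obtain g' where g: "continuous_on {0..L} g" "L2_function (interval_measure L) g"
    "L2_function (interval_measure L) g'" "weak_derivative {0<..<L} g g'"
    using assms(2) by (rule continuous_H1E)
  have "continuous_on {0..L} (\<lambda>t. a * f t + b * g t)"
    using f(1) g(1) by (intro continuous_intros)
  then show ?thesis
    unfolding continuous_H1_def H1_interval_iff
    using weak_derivative_linear[OF f(2) g(2) f(3) g(3) f(4) g(4), of a b]
      L2_function_add[OF L2_function_cmult[OF f(3), of a] L2_function_cmult[OF g(3), of b]]
      continuous_imp_L2_function
    by blast
qed

text \<open>The energy is a quadratic form with polar form \<open>c\<close>, the H1 inner product of
  \<open>f\<close> and \<open>g\<close>. Its value never matters, as the cross terms vanish or
  cancel wherever this is applied.\<close>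

lemma interval_energy_linear:
  assumes "f \<in> continuous_H1 L" and "g \<in> continuous_H1 L"
  obtains c where "\<And>a b. interval_energy L (\<lambda>t. a * f t + b * g t)
    = a\<^sup>2 * interval_energy L f + b\<^sup>2 * interval_energy L g + 2 * a * b * c"
proof -
  let ?M = "interval_measure L"
  obtain f' where f: "continuous_on {0..L} f" "L2_function ?M f"
    "L2_function ?M f'" "weak_derivative {0<..<L} f f'"
    "interval_energy L f = (LINT t|?M. (f' t)\<^sup>2) + (LINT t|?M. (f t)\<^sup>2)"
    using assms(1) by (rule continuous_H1E)
  obtain g' where g: "continuous_on {0..L} g" "L2_function ?M g"
    "L2_function ?M g'" "weak_derivative {0<..<L} g g'"
    "interval_energy L g = (LINT t|?M. (g' t)\<^sup>2) + (LINT t|?M. (g t)\<^sup>2)"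
    using assms(2) by (rule continuous_H1E)
  have sq: "(LINT t|?M. (a * u t + b * v t)\<^sup>2)
      = a\<^sup>2 * (LINT t|?M. (u t)\<^sup>2) + b\<^sup>2 * (LINT t|?M. (v t)\<^sup>2) + 2 * a * b * (LINT t|?M. u t * v t)"
    if "L2_function ?M u" "L2_function ?M v" for u v a b
  proof -
    have "(LINT t|?M. (a * u t + b * v t)\<^sup>2)
        = (LINT t|?M. a\<^sup>2 * (u t)\<^sup>2 + b\<^sup>2 * (v t)\<^sup>2 + 2 * a * b * (u t * v t))"
      by (rule Bochner_Integration.integral_cong) (auto simp: power2_eq_square algebra_simps)
    then show ?thesis
      using that L2_function_integrable_mult[OF that] by (simp add: L2_function_integrable_square)
  qed
  have "interval_energy L (\<lambda>t. a * f t + b * g t)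
      = a\<^sup>2 * interval_energy L f + b\<^sup>2 * interval_energy L g
        + 2 * a * b * ((LINT t|?M. f' t * g' t) + (LINT t|?M. f t * g t))" for a b
  proof -
    have "continuous_on {0..L} (\<lambda>t. a * f t + b * g t)"
      using f(1) g(1) by (intro continuous_intros)
    then have "interval_energy L (\<lambda>t. a * f t + b * g t)
        = (LINT t|?M. (a * f' t + b * g' t)\<^sup>2) + (LINT t|?M. (a * f t + b * g t)\<^sup>2)"
      using weak_derivative_linear[OF f(2) g(2) f(3) g(3) f(4) g(4), of a b]
        L2_function_add[OF L2_function_cmult[OF f(3), of a] L2_function_cmult[OF g(3), of b]]
      by (intro interval_energy_eq[OF L])
    then show ?thesis
      by (simp add: sq f g algebra_simps)
  qed
  then show ?thesis by (rule that)
qed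

lemma interval_energy_ge: "f \<in> continuous_H1 L \<Longrightarrow>
    (LINT t|interval_measure L. (f t)\<^sup>2) \<le> interval_energy L f"
  by (erule continuous_H1E) simp

lemma interval_energy_nonneg: "0 \<le> interval_energy L f"
  by (simp add: interval_energy_def set_integral_interval)

text \<open>Cauchy-Schwarz for the weak derivative against the indicator of \<open>(s, t)\<close>,
  whose squared L2 norm is \<open>t - s\<close>.\<close>

lemma continuous_H1_Holder:
  assumes "f \<in> continuous_H1 L" and s: "s \<in> {0..L}" and t: "t \<in> {0..L}"
  shows "(f t - f s)\<^sup>2 \<le> \<bar>t - s\<bar> * interval_energy L f"
proof -
  let ?M = "interval_measure L"
  obtain g where f: "continuous_on {0..L} f" "L2_function ?M f"
    "L2_function ?M g" "weak_derivative {0<..<L} f g"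
    "interval_energy L f = (LINT t|?M. (g t)\<^sup>2) + (LINT t|?M. (f t)\<^sup>2)"
    using assms(1) by (rule continuous_H1E)
  have *: "(f t - f s)\<^sup>2 \<le> (t - s) * interval_energy L f" if "0 \<le> s" "s < t" "t \<le> L" for s t
  proof -
    have "(f t - f s)\<^sup>2 = (LINT x|?M. indicator {s<..<t} x * g x)\<^sup>2"
      using weak_derivative_imp_integral[OF f(1,3,4) that] by simp
    also have "\<dots> \<le> (LINT x|?M. (indicator {s<..<t} x)\<^sup>2) * (LINT x|?M. (g x)\<^sup>2)"
      by (rule L2_Cauchy_Schwarz[OF L2_function_indicator f(3)])
    also have "(LINT x|?M. (indicator {s<..<t} x)\<^sup>2) = t - s"
    proof -
      have "(LINT x|?M. (indicator {s<..<t} x)\<^sup>2) = (LINT x|lborel. indicator {s<..<t} x :: real)"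
        unfolding integral_restrict_space[of "{0<..<L}" lborel, simplified]
        by (rule Bochner_Integration.integral_cong) (use that in \<open>auto simp: indicator_def\<close>)
      then show ?thesis using that by simp
    qed
    also have "(t - s) * (LINT x|?M. (g x)\<^sup>2) \<le> (t - s) * interval_energy L f"
      using that unfolding f(5) by (intro mult_left_mono) auto
    finally show ?thesis .
  qed
  show ?thesis
  proof (cases s t rule: linorder_cases)
    case less
    then show ?thesis using *[of s t] s t by auto
  next
    case greater
    then show ?thesis using *[of t s] s t by (auto simp: power2_commute)
  qed simp
qed

text \<open>Integrate \<open>(f t)\<^sup>2 \<le> 2 * (f t - f s)\<^sup>2 + 2 * (f s)\<^sup>2\<close>
  over \<open>s\<close> and divide by \<open>L\<close>: the Hoelder term contributes
  \<open>2 * L\<close>, the L2 norm \<open>2 / L\<close>.\<close>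

lemma continuous_H1_sup_bound:
  assumes f: "f \<in> continuous_H1 L" and t: "t \<in> {0..L}"
  shows "(f t)\<^sup>2 \<le> (2 * L + 2 / L) * interval_energy L f"
proof -
  let ?M = "interval_measure L" and ?E = "interval_energy L f"
  interpret finite_measure ?M by simp
  have f2: "L2_function ?M f" using f by (rule continuous_H1E)
  have "(LINT s|?M. (f t)\<^sup>2) \<le> (LINT s|?M. 2 * L * ?E + 2 * (f s)\<^sup>2)"
  proof (rule integral_mono)
    fix s assume "s \<in> space ?M"
    then have s: "s \<in> {0..L}" by simp
    have "(f t - f s)\<^sup>2 \<le> \<bar>t - s\<bar> * ?E" by (rule continuous_H1_Holder[OF f s t])
    also have "\<dots> \<le> L * ?E"
      using s t interval_energy_nonneg by (intro mult_right_mono) auto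
    finally have "(f t - f s)\<^sup>2 \<le> L * ?E" .
    \<comment> \<open>The difference of the two sides is exactly
      \<open>(f t - 2 * f s)\<^sup>2\<close>.\<close>
    moreover have "(f t)\<^sup>2 \<le> 2 * (f t - f s)\<^sup>2 + 2 * (f s)\<^sup>2"
      using zero_le_power2[of "f t - 2 * f s"] by (simp add: power2_eq_square algebra_simps)
    ultimately show "(f t)\<^sup>2 \<le> 2 * L * ?E + 2 * (f s)\<^sup>2" by simp
  qed (use f2 in \<open>auto simp: L2_function_integrable_square\<close>)
  also have "\<dots> = L * (2 * L * ?E) + 2 * (LINT s|?M. (f s)\<^sup>2)"
    using f2 L by (simp add: L2_function_integrable_square measure_interval_measure)
  also have "\<dots> \<le> L * (2 * L * ?E) + 2 * ?E"
    using interval_energy_ge[OF f] by simp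
  finally have "L * (f t)\<^sup>2 \<le> L * (2 * L * ?E) + 2 * ?E"
    using L by (simp add: measure_interval_measure)
  also have "\<dots> = L * ((2 * L + 2 / L) * ?E)"
    using L by (simp add: field_simps)
  finally show ?thesis using L by simp
qed

text \<open>The energy of a difference dominates the L2 norm of the difference of the weak
  derivatives, so these have an L2 limit. Uniform convergence identifies it as the weak derivative
  of \<open>f'\<close>.\<close>

lemma continuous_H1_complete:
  assumes f: "\<And>n. f n \<in> continuous_H1 L" and f': "continuous_on {0..L} f'"
    and unif: "\<And>e. e > 0 \<Longrightarrow> \<exists>N. \<forall>n\<ge>N. \<forall>x\<in>{0..L}. \<bar>f n x - f' x\<bar> < e"
    and cauchy: "\<And>e. e > 0 \<Longrightarrow> \<exists>N. \<forall>i\<ge>N. \<forall>j\<ge>N. interval_energy L (\<lambda>t. f i t - f j t) < e"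
  shows "f' \<in> continuous_H1 L" and "(\<lambda>n. interval_energy L (f n)) \<longlonglongrightarrow> interval_energy L f'"
proof -
  let ?M = "interval_measure L"
  have "\<exists>g. continuous_on {0..L} (f n) \<and> L2_function ?M (f n) \<and>
    L2_function ?M g \<and> weak_derivative {0<..<L} (f n) g \<and>
    interval_energy L (f n) = (LINT t|?M. (g t)\<^sup>2) + (LINT t|?M. (f n t)\<^sup>2)" for n
    using f[of n] by (rule continuous_H1E) blast
  then obtain g where g: "\<And>n. continuous_on {0..L} (f n)" "\<And>n. L2_function ?M (f n)"
    "\<And>n. L2_function ?M (g n)" "\<And>n. weak_derivative {0<..<L} (f n) (g n)"
    "\<And>n. interval_energy L (f n) = (LINT t|?M. (g n t)\<^sup>2) + (LINT t|?M. (f n t)\<^sup>2)"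
    by metis
  have diff: "(LINT t|?M. (g i t - g j t)\<^sup>2) \<le> interval_energy L (\<lambda>t. f i t - f j t)" for i j
  proof -
    have "continuous_on {0..L} (\<lambda>t. f i t - f j t)"
      using g(1) by (intro continuous_intros)
    moreover have "weak_derivative {0<..<L} (\<lambda>t. f i t - f j t) (\<lambda>t. g i t - g j t)"
      using weak_derivative_linear[OF g(2)[of i] g(2)[of j] g(3)[of i] g(3)[of j] g(4)[of i] g(4)[of j], of 1 "-1"] by simp
    ultimately have "interval_energy L (\<lambda>t. f i t - f j t)
      = (LINT t|?M. (g i t - g j t)\<^sup>2) + (LINT t|?M. (f i t - f j t)\<^sup>2)"
      using L2_function_diff[OF g(3)[of i] g(3)[of j]] by (intro interval_energy_eq[OF L])
    then show ?thesis by simp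
  qed
  obtain g' where g': "L2_function ?M g'" and lim: "(\<lambda>n. LINT x|?M. (g n x - g' x)\<^sup>2) \<longlonglongrightarrow> 0"
  proof (rule L2_complete[OF finite_measure_interval_measure g(3)])
    show "\<exists>N. \<forall>i\<ge>N. \<forall>j\<ge>N. (LINT x|?M. (g i x - g j x)\<^sup>2) < e" if "e > 0" for e
      using cauchy[OF that] diff by (meson le_less_trans)
  qed blast
  note lims = weak_derivative_limit[OF g(1) f' unif g(3) g' lim g(4) L]
  have f'2: "L2_function ?M f'" using f' by (rule continuous_imp_L2_function)
  show "f' \<in> continuous_H1 L"
    unfolding continuous_H1_def H1_interval_iff using f' f'2 g' lims(2) by blast
  have E: "interval_energy L f' = (LINT t|?M. (g' t)\<^sup>2) + (LINT t|?M. (f' t)\<^sup>2)"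
    by (rule interval_energy_eq[OF L f' g' lims(2)])
  show "(\<lambda>n. interval_energy L (f n)) \<longlonglongrightarrow> interval_energy L f'"
    unfolding g(5) E
    by (intro tendsto_add L2_limit_integral_square[OF g(3) g' lim] L2_limit_integral_square[OF g(2) f'2 lims(1)])
qed

end

subsection \<open>Compact metric graphs\<close>

text \<open>Half-lines do not occur in a bounded graph; \<open>0\<close> is a junk value.\<close>

fun edge_length :: "edge \<Rightarrow> real" where
  "edge_length (Segment a b) = dist a b"
| "edge_length (Halfline a u) = 0"

definition Lp_mass :: "real \<Rightarrow> plane_graph \<Rightarrow> (point \<Rightarrow> real) \<Rightarrow> real" where
  "Lp_mass p G w = graph_integral G (\<lambda>e t. \<bar>on_edge w e t\<bar> powr p)"

locale compact_metric_graph = metric_graph +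
  assumes locally_finite: "locally_finite_graph G" and bounded: "bounded_graph G"
begin

lemmas finite_edges = bounded_locally_finite_imp_compact(1)[OF locally_finite bounded]
lemmas compact_graph_points = bounded_locally_finite_imp_compact(3)[OF locally_finite bounded]

lemma edge_cases:
  assumes "e \<in> edges G"
  obtains a b where "e = Segment a b" "a \<noteq> b"
  using bounded_locally_finite_imp_compact(2)[OF locally_finite bounded assms] segment assms by blast

lemma edge_interval_eq: "e \<in> edges G \<Longrightarrow> edge_interval e = {0<..<edge_length e}"
  by (erule edge_cases) simp

lemma edge_length_pos: "e \<in> edges G \<Longrightarrow> 0 < edge_length e"
  by (erule edge_cases) simp

lemma edge_points_eq:
  assumes "e \<in> edges G"
  shows "edge_points e = edge_param e ` {0..edge_length e}"
  using assms
proof (rule edge_cases)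
  fix a b assume e: "e = Segment a b" and "a \<noteq> b"
  then have l: "0 < dist a b" by simp
  have param: "edge_param e (dist a b * r) = (1 - r) *\<^sub>R a + r *\<^sub>R b" for r
    using l by (simp add: e sgn_div_norm dist_norm norm_minus_commute algebra_simps)
  show ?thesis
  proof (intro equalityI subsetI)
    fix x assume "x \<in> edge_points e"
    then obtain r where r: "0 \<le> r" "r \<le> 1" "x = (1 - r) *\<^sub>R a + r *\<^sub>R b"
      by (auto simp: e closed_segment_def)
    then have "x = edge_param e (dist a b * r)" by (simp only: param)
    moreover have "dist a b * r \<in> {0..edge_length e}"
      using r l by (simp add: e mult_left_le)
    ultimately show "x \<in> edge_param e ` {0..edge_length e}" by (rule image_eqI)
  next
    fix x assume "x \<in> edge_param e ` {0..edge_length e}"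
    then obtain t where t: "0 \<le> t" "t \<le> dist a b" "x = edge_param e t"
      by (auto simp: e)
    define r where "r = t / dist a b"
    have r: "t = dist a b * r" "0 \<le> r" "r \<le> 1" using t l by (auto simp: r_def)
    have "x = (1 - r) *\<^sub>R a + r *\<^sub>R b" by (simp only: t(3) r(1) param)
    then show "x \<in> edge_points e"
      unfolding e edge_points.simps closed_segment_def using r by blast
  qed
qed

lemma dist_edge_param:
  assumes "e \<in> edges G"
  shows "dist (edge_param e s) (edge_param e t) = \<bar>s - t\<bar>"
  using assms
proof (rule edge_cases)
  fix a b assume e: "e = Segment a b" "a \<noteq> b"
  have "edge_param e s - edge_param e t = (s - t) *\<^sub>R sgn (b - a)"
    by (simp add: e(1) scaleR_left_diff_distrib)
  then show ?thesis using e(2) by (simp add: dist_norm norm_sgn)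
qed

lemma edge_param_in:
  "e \<in> edges G \<Longrightarrow> t \<in> {0..edge_length e} \<Longrightarrow> edge_param e t \<in> edge_points e"
  by (simp add: edge_points_eq)

lemma edge_ends_subset: "e \<in> edges G \<Longrightarrow> edge_ends e \<subseteq> edge_points e"
  by (erule edge_cases) simp

lemma graph_points_eq: "graph_points G = (\<Union>e\<in>edges G. edge_points e)"
  using edge_ends_subset by (auto simp: graph_points_def verts_eq)

lemma compact_edge_points: "e \<in> edges G \<Longrightarrow> compact (edge_points e)"
  by (erule edge_cases) simp

lemma continuous_on_edge:
  assumes "continuous_on (graph_points G) w" and e: "e \<in> edges G"
  shows "continuous_on {0..edge_length e} (on_edge w e)"
proof -
  have "continuous_on UNIV (edge_param e)"
    using dist_edge_param[OF e] by (auto simp: continuous_on_iff dist_real_def)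
  then show ?thesis
    unfolding on_edge_def[abs_def]
    using assms edge_param_in[OF e]
    by (intro continuous_on_compose2[OF assms(1)]) (auto intro: continuous_on_subset simp: graph_points_eq)
qed

text \<open>Summability of the edge norms holds as there are finitely many edges, and continuity on
  the graph gives continuity up to the ends of each edge.\<close>

lemma H10_iff:
  "w \<in> H10 G \<longleftrightarrow> continuous_on (graph_points G) w \<and>
    (\<forall>e\<in>edges G. on_edge w e \<in> continuous_H1 (edge_length e)) \<and> (\<forall>x\<in>outer G. w x = 0)"
proof -
  have "on_edge w e \<in> H1_interval (edge_interval e) \<longleftrightarrow> on_edge w e \<in> continuous_H1 (edge_length e)"
    if "continuous_on (graph_points G) w" "e \<in> edges G" for e
    using continuous_on_edge[OF that] by (simp add: continuous_H1_def edge_interval_eq[OF that(2)])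
  moreover have "(\<lambda>e. (H1_edge_norm e w)\<^sup>2) summable_on edges G"
    using finite_edges by simp
  ultimately show ?thesis unfolding H10_def H1_def by blast
qed

lemma H1_energy_eq:
  "H1_energy G w = (\<Sum>e\<in>edges G. interval_energy (edge_length e) (on_edge w e))"
  unfolding H1_energy_def graph_integral_def
  by (simp add: finite_edges interval_energy_def edge_deriv_def edge_interval_eq)

lemma Lp_mass_eq:
  "Lp_mass p G w = (\<Sum>e\<in>edges G. LINT t|interval_measure (edge_length e). \<bar>on_edge w e t\<bar> powr p)"
  unfolding Lp_mass_def graph_integral_def
  by (simp add: finite_edges edge_interval_eq set_integral_interval)

lemma Lp_norm_sq_eq: "Lp_norm_sq p G w = Lp_mass p G w powr (2 / p)"
  by (simp add: Lp_norm_sq_def Lp_mass_def)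

section \<open>The energy on the graph as a quadratic form\<close>

lemma H10_linear:
  assumes "w \<in> H10 G" and "v \<in> H10 G"
  shows "(\<lambda>x. a * w x + b * v x) \<in> H10 G"
  unfolding H10_iff
proof (intro conjI ballI)
  show "continuous_on (graph_points G) (\<lambda>x. a * w x + b * v x)"
    using assms by (auto simp: H10_iff intro!: continuous_intros)
  show "on_edge (\<lambda>x. a * w x + b * v x) e \<in> continuous_H1 (edge_length e)" if "e \<in> edges G" for e
    using assms that continuous_H1_linear[OF edge_length_pos[OF that], of "on_edge w e" "on_edge v e" a b]
    by (auto simp: H10_iff on_edge_def[abs_def])
qed (use assms in \<open>auto simp: H10_iff\<close>)

text \<open>The polar forms of the edges add up to one \<open>c\<close> that does not depend on
  \<open>a\<close> and \<open>b\<close>. Scaling and the parallelogram identity are the cases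
  \<open>b = 0\<close> and \<open>a = 1\<close>, \<open>b = 1\<close> or \<open>-1\<close>.\<close>

lemma H1_energy_linear:
  assumes "w \<in> H10 G" and "v \<in> H10 G"
  obtains c where "\<And>a b. H1_energy G (\<lambda>x. a * w x + b * v x)
    = a\<^sup>2 * H1_energy G w + b\<^sup>2 * H1_energy G v + 2 * a * b * c"
proof -
  have "\<forall>e\<in>edges G. \<exists>c. \<forall>a b. interval_energy (edge_length e) (on_edge (\<lambda>x. a * w x + b * v x) e)
    = a\<^sup>2 * interval_energy (edge_length e) (on_edge w e)
      + b\<^sup>2 * interval_energy (edge_length e) (on_edge v e) + 2 * a * b * c"
  proof
    fix e assume e: "e \<in> edges G"
    then obtain c where "\<And>a b. interval_energy (edge_length e) (\<lambda>t. a * on_edge w e t + b * on_edge v e t)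
      = a\<^sup>2 * interval_energy (edge_length e) (on_edge w e)
      + b\<^sup>2 * interval_energy (edge_length e) (on_edge v e) + 2 * a * b * c"
      using interval_energy_linear[OF edge_length_pos[OF e], of "on_edge w e" "on_edge v e"] assms
      by (auto simp: H10_iff)
    then show "\<exists>c. \<forall>a b. interval_energy (edge_length e) (on_edge (\<lambda>x. a * w x + b * v x) e)
      = a\<^sup>2 * interval_energy (edge_length e) (on_edge w e)
        + b\<^sup>2 * interval_energy (edge_length e) (on_edge v e) + 2 * a * b * c"
      by (auto simp: on_edge_def[abs_def])
  qed
  from bchoice[OF this] obtain c where c: "\<And>e a b. e \<in> edges G \<Longrightarrow>
    interval_energy (edge_length e) (on_edge (\<lambda>x. a * w x + b * v x) e)
    = a\<^sup>2 * interval_energy (edge_length e) (on_edge w e)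
      + b\<^sup>2 * interval_energy (edge_length e) (on_edge v e) + 2 * a * b * c e" by blast
  show ?thesis
  proof (rule that)
    show "H1_energy G (\<lambda>x. a * w x + b * v x)
      = a\<^sup>2 * H1_energy G w + b\<^sup>2 * H1_energy G v + 2 * a * b * sum c (edges G)" for a b
      by (simp add: H1_energy_eq c sum.distrib sum_distrib_left)
  qed
qed

lemma H1_energy_cmult:
  assumes "w \<in> H10 G"
  shows "H1_energy G (\<lambda>x. c * w x) = c\<^sup>2 * H1_energy G w"
proof -
  obtain d where "\<And>a b. H1_energy G (\<lambda>x. a * w x + b * w x)
    = a\<^sup>2 * H1_energy G w + b\<^sup>2 * H1_energy G w + 2 * a * b * d"
    using H1_energy_linear[OF assms assms] by blast
  from this[of c 0] show ?thesis by simp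
qed

lemma H1_energy_parallelogram:
  assumes "w \<in> H10 G" and "v \<in> H10 G"
  shows "H1_energy G (\<lambda>x. w x - v x) + H1_energy G (\<lambda>x. w x + v x) = 2 * H1_energy G w + 2 * H1_energy G v"
proof -
  obtain d where "\<And>a b. H1_energy G (\<lambda>x. a * w x + b * v x)
    = a\<^sup>2 * H1_energy G w + b\<^sup>2 * H1_energy G v + 2 * a * b * d"
    using H1_energy_linear[OF assms] by blast
  from this[of 1 1] this[of 1 "-1"] show ?thesis by simp
qed

lemma H1_energy_nonneg: "0 \<le> H1_energy G w"
  unfolding H1_energy_eq using interval_energy_nonneg[OF edge_length_pos] by (intro sum_nonneg)

lemma interval_energy_le:
  assumes "e \<in> edges G"
  shows "interval_energy (edge_length e) (on_edge w e) \<le> H1_energy G w"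
  unfolding H1_energy_eq
  using assms finite_edges interval_energy_nonneg[OF edge_length_pos]
  by (intro member_le_sum) auto

section \<open>Sobolev estimates on the graph\<close>

text \<open>Edges are straight, so on a single edge the distance in the plane is arc length. Between
  different edges it need not be, which is why both points lie on one edge.\<close>

lemma H10_Holder:
  assumes w: "w \<in> H10 G" and e: "e \<in> edges G" and "x \<in> edge_points e" "y \<in> edge_points e"
  shows "(w x - w y)\<^sup>2 \<le> dist x y * H1_energy G w"
proof -
  obtain s t where st: "s \<in> {0..edge_length e}" "t \<in> {0..edge_length e}"
    "x = edge_param e t" "y = edge_param e s"
    using assms(3,4) edge_points_eq[OF e] by auto
  have "(w x - w y)\<^sup>2 \<le> dist x y * interval_energy (edge_length e) (on_edge w e)"
    using continuous_H1_Holder[OF edge_length_pos[OF e] _ st(1,2), of "on_edge w e"] w e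
    by (simp add: H10_iff st(3,4) on_edge_def dist_edge_param)
  also have "\<dots> \<le> dist x y * H1_energy G w"
    using interval_energy_le[OF e] by (intro mult_left_mono) auto
  finally show ?thesis .
qed

lemma H10_sup_bound:
  obtains C where "0 \<le> C" and "\<And>w x. w \<in> H10 G \<Longrightarrow> x \<in> graph_points G \<Longrightarrow> (w x)\<^sup>2 \<le> C * H1_energy G w"
proof
  let ?c = "\<lambda>e. 2 * edge_length e + 2 / edge_length e"
  have c: "0 \<le> ?c e" if "e \<in> edges G" for e using edge_length_pos[OF that] by simp
  then show "0 \<le> sum ?c (edges G)" by (rule sum_nonneg)
  fix w x assume w: "w \<in> H10 G" and "x \<in> graph_points G"
  then obtain e where e: "e \<in> edges G" "x \<in> edge_points e" by (auto simp: graph_points_eq)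
  then obtain t where t: "t \<in> {0..edge_length e}" "x = edge_param e t"
    using edge_points_eq by auto
  have "(w x)\<^sup>2 \<le> ?c e * interval_energy (edge_length e) (on_edge w e)"
    using continuous_H1_sup_bound[OF edge_length_pos[OF e(1)] _ t(1), of "on_edge w e"] w e
    by (simp add: H10_iff t(2) on_edge_def)
  also have "\<dots> \<le> sum ?c (edges G) * H1_energy G w"
    using c e interval_energy_le[OF e(1)] finite_edges
    by (intro mult_mono member_le_sum sum_nonneg interval_energy_nonneg edge_length_pos) auto
  finally show "(w x)\<^sup>2 \<le> sum ?c (edges G) * H1_energy G w" .
qed

text \<open>Equicontinuity at the point \<open>x\<close>, uniformly for energy at most
  \<open>K\<close>. Edges through \<open>x\<close> obey the Hoelder bound; the others are compact
  and stay at a positive distance from \<open>x\<close>. The minimum over finitely many edges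
  remains positive.\<close>

lemma H10_equicontinuous:
  assumes x: "x \<in> graph_points G" and \<epsilon>: "0 < \<epsilon>" and K: "0 \<le> K"
  obtains d where "0 < d" and "\<And>w y. w \<in> H10 G \<Longrightarrow> H1_energy G w \<le> K \<Longrightarrow> y \<in> graph_points G \<Longrightarrow>
    dist x y < d \<Longrightarrow> \<bar>w x - w y\<bar> < \<epsilon>"
proof -
  have "\<forall>e\<in>edges G. \<exists>d>0. \<forall>w y. w \<in> H10 G \<and> H1_energy G w \<le> K \<and> y \<in> edge_points e \<and> dist x y < d
    \<longrightarrow> \<bar>w x - w y\<bar> < \<epsilon>"
  proof
    fix e assume e: "e \<in> edges G"
    show "\<exists>d>0. \<forall>w y. w \<in> H10 G \<and> H1_energy G w \<le> K \<and> y \<in> edge_points e \<and> dist x y < d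
      \<longrightarrow> \<bar>w x - w y\<bar> < \<epsilon>"
    proof (cases "x \<in> edge_points e")
      case False
      then obtain d where "d > 0" "\<forall>y\<in>edge_points e. d \<le> dist x y"
        using separate_point_closed[of "edge_points e" x] compact_edge_points[OF e] compact_imp_closed by blast
      then show ?thesis by (intro exI[of _ d]) fastforce
    next
      case True
      show ?thesis
      \<comment> \<open>The Hoelder bound gives
        \<open>(w x - w y)\<^sup>2 \<le> dist x y * K\<close>; the \<open>+ 1\<close> allows
        \<open>K = 0\<close>.\<close>
      proof (intro exI[of _ "\<epsilon>\<^sup>2 / (K + 1)"] conjI allI impI)
        show "0 < \<epsilon>\<^sup>2 / (K + 1)" using \<epsilon> K by simp
        fix w y assume *: "w \<in> H10 G \<and> H1_energy G w \<le> K \<and> y \<in> edge_points e \<and> dist x y < \<epsilon>\<^sup>2 / (K + 1)"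
        then have "w \<in> H10 G" "y \<in> edge_points e" by auto
        from H10_Holder[OF this(1) e True this(2)]
        have "(w x - w y)\<^sup>2 \<le> dist x y * H1_energy G w" .
        also have "\<dots> \<le> dist x y * (K + 1)"
          using conjunct1[OF conjunct2[OF *]] by (intro mult_left_mono) auto
        also have "\<dots> < \<epsilon>\<^sup>2"
          using conjunct2[OF conjunct2[OF conjunct2[OF *]]] K by (simp add: pos_less_divide_eq)
        finally have "\<bar>w x - w y\<bar>\<^sup>2 < \<epsilon>\<^sup>2" by simp
        then show "\<bar>w x - w y\<bar> < \<epsilon>" using \<epsilon> by (rule power2_less_imp_less[OF _ less_imp_le])
      qed
    qed
  qed
  from bchoice[OF this] obtain d where d: "\<forall>e\<in>edges G. 0 < d e \<and> (\<forall>w y. w \<in> H10 G \<and>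
    H1_energy G w \<le> K \<and> y \<in> edge_points e \<and> dist x y < d e \<longrightarrow> \<bar>w x - w y\<bar> < \<epsilon>)" ..
  show ?thesis
  proof (rule that[of "Min (d ` edges G)"])
    show "0 < Min (d ` edges G)" using d finite_edges nonempty by simp
    fix w y assume *: "w \<in> H10 G" "H1_energy G w \<le> K" "y \<in> graph_points G" "dist x y < Min (d ` edges G)"
    then obtain e where e: "e \<in> edges G" "y \<in> edge_points e" by (auto simp: graph_points_eq)
    then have "dist x y < d e" using * finite_edges nonempty by simp
    from d[rule_format, OF e(1), THEN conjunct2, rule_format, of w y] this e(2) *(1,2)
    show "\<bar>w x - w y\<bar> < \<epsilon>" by blast
  qed
qed

section \<open>The integral of the \<open>p\<close>-th power\<close>

lemma continuous_on_abs_powr: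
  assumes "continuous_on S f" and "0 < p"
  shows "continuous_on S (\<lambda>t. \<bar>f t :: real\<bar> powr p)"
  using assms by (intro continuous_on_powr') (auto intro!: continuous_intros)

lemma Lp_mass_nonneg: "0 \<le> Lp_mass p G w"
  unfolding Lp_mass_eq by (intro sum_nonneg) simp

lemma Lp_mass_cmult: "Lp_mass p G (\<lambda>x. c * w x) = \<bar>c\<bar> powr p * Lp_mass p G w"
  by (simp add: Lp_mass_eq on_edge_def abs_mult powr_mult sum_distrib_left)

lemma Lp_norm_sq_cmult:
  assumes "0 < p"
  shows "Lp_norm_sq p G (\<lambda>x. c * w x) = c\<^sup>2 * Lp_norm_sq p G w"
proof -
  have "(\<bar>c\<bar> powr p) powr (2 / p) = c\<^sup>2"
    using assms by (cases "c = 0") (auto simp: powr_powr powr_numeral)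
  then show ?thesis
    by (simp add: Lp_norm_sq_eq Lp_mass_cmult powr_mult)
qed

text \<open>Otherwise the integral of the continuous nonnegative function \<open>h\<close> over the
  edge containing \<open>x\<close> is 0, which forces \<open>h\<close> to vanish there.\<close>

lemma Lp_mass_pos:
  assumes p: "0 < p" and w: "w \<in> H10 G" and x: "x \<in> graph_points G" "w x \<noteq> 0"
  shows "0 < Lp_mass p G w"
proof (rule ccontr)
  assume "\<not> 0 < Lp_mass p G w"
  then have zero: "Lp_mass p G w = 0" using Lp_mass_nonneg[of p w] by simp
  obtain e where e: "e \<in> edges G" "x \<in> edge_points e" using x by (auto simp: graph_points_eq)
  define L where "L = edge_length e"
  define h where "h t = \<bar>on_edge w e t\<bar> powr p" for t
  have L: "0 < L" using e edge_length_pos by (simp add: L_def)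
  obtain t where t: "t \<in> {0..L}" "x = edge_param e t"
    using e edge_points_eq unfolding L_def by auto
  have cont: "continuous_on {0..L} h"
    unfolding h_def L_def using w e p by (intro continuous_on_abs_powr continuous_on_edge) (auto simp: H10_iff)
  have "(LINT t|interval_measure L. h t) = 0"
    using zero e(1) finite_edges unfolding Lp_mass_eq L_def h_def
    by (subst (asm) sum_nonneg_eq_0_iff) auto
  then have "(LBINT t:{0<..<L}. h t) = 0" by (simp add: set_integral_interval)
  moreover have "set_integrable lborel {0<..<L} h"
    using borel_integrable_atLeastAtMost'[OF cont] by (rule set_integrable_subset) auto
  ultimately have "integral {0<..<L} h = 0"
    using set_borel_integral_eq_integral(2)[of "{0<..<L}" h] by simp
  \<comment> \<open>The closed interval is needed because \<open>x\<close> may be a vertex, that is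
    \<open>t = 0\<close> or \<open>t = L\<close>.\<close>
  then have "integral {0..L} h = 0"
    using integral_open_interval_real[of 0 L h] by simp
  then have "h t = 0"
    using integral_eq_0_iff[OF cont L] t by (simp add: h_def)
  then show False using x t by (simp add: h_def on_edge_def)
qed

lemma Lp_mass_limit:
  assumes p: "0 < p" and u: "\<And>n. continuous_on (graph_points G) (u n)" "continuous_on (graph_points G) v"
    and lim: "\<And>x. x \<in> graph_points G \<Longrightarrow> (\<lambda>n. u n x) \<longlonglongrightarrow> v x"
    and B: "\<And>n x. x \<in> graph_points G \<Longrightarrow> \<bar>u n x\<bar> \<le> B"
  shows "(\<lambda>n. Lp_mass p G (u n)) \<longlonglongrightarrow> Lp_mass p G v"
  unfolding Lp_mass_eq
proof (rule tendsto_sum)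
  fix e assume e: "e \<in> edges G"
  let ?M = "interval_measure (edge_length e)"
  interpret finite_measure ?M by simp
  have pts: "edge_param e t \<in> graph_points G" if "t \<in> space ?M" for t
    using that edge_param_in[OF e, of t] e by (auto simp: graph_points_eq)
  have meas: "(\<lambda>t. \<bar>on_edge w e t\<bar> powr p) \<in> borel_measurable ?M" if "continuous_on (graph_points G) w" for w
    using continuous_imp_L2_function[OF continuous_on_abs_powr[OF continuous_on_edge[OF that e] p]]
    by (simp add: L2_function_def)
  show "(\<lambda>n. LINT t|?M. \<bar>on_edge (u n) e t\<bar> powr p) \<longlonglongrightarrow> (LINT t|?M. \<bar>on_edge v e t\<bar> powr p)"
  proof (rule integral_dominated_convergence[where w="\<lambda>_. B powr p"])
    show "AE t in ?M. (\<lambda>n. \<bar>on_edge (u n) e t\<bar> powr p) \<longlonglongrightarrow> \<bar>on_edge v e t\<bar> powr p"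
    proof (rule AE_I2)
      fix t assume "t \<in> space ?M"
      then have "(\<lambda>n. \<bar>on_edge (u n) e t\<bar>) \<longlonglongrightarrow> \<bar>on_edge v e t\<bar>"
        unfolding on_edge_def using lim[OF pts] by (intro tendsto_rabs)
      then show "(\<lambda>n. \<bar>on_edge (u n) e t\<bar> powr p) \<longlonglongrightarrow> \<bar>on_edge v e t\<bar> powr p"
        using p by (intro tendsto_powr') auto
    qed
    show "AE t in ?M. norm (\<bar>on_edge (u n) e t\<bar> powr p) \<le> B powr p" for n
      using B[OF pts] p by (intro AE_I2) (auto simp: on_edge_def intro!: powr_mono2)
  qed (use meas u in auto)
qed

text \<open>Without a nonzero function the infimum would be an arbitrary value. A bump on one edge,
  zero at both ends, extends by 0 to the rest of the graph because by planarity the other edges meet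
  it at most at its ends.\<close>

lemma H10_nonzero_nonempty: "H10_nonzero G \<noteq> {}"
proof -
  obtain e where e: "e \<in> edges G" using nonempty by blast
  then obtain a b where ab: "e = Segment a b" "a \<noteq> b" by (rule edge_cases)
  define L where "L = dist a b"
  have L: "0 < L" "edge_length e = L" using ab by (auto simp: L_def)
  \<comment> \<open>In arc length this product of distances to the ends is the parabola
    \<open>t * (L - t)\<close>.\<close>
  define w where "w x = (if x \<in> edge_points e then dist a x * dist b x else 0)" for x
  have ends: "w x = 0" if "x \<notin> edge_points e \<or> x \<in> edge_ends e" for x
    using that by (auto simp: w_def ab(1))
  have other: "w x = 0" if "e' \<in> edges G" "e' \<noteq> e" "x \<in> edge_points e'" for e' x
    using planar[OF e that(1)] that ends by blast
  \<comment> \<open>Gluing along two closed sets; the union of the other edges is closed since there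
    are finitely many.\<close>
  have "continuous_on (edge_points e \<union> (\<Union>e'\<in>edges G - {e}. edge_points e')) w"
    unfolding w_def
  proof (rule continuous_on_cases)
    show "closed (edge_points e)" using compact_edge_points[OF e] by (rule compact_imp_closed)
    show "closed (\<Union>e'\<in>edges G - {e}. edge_points e')"
      using finite_edges compact_edge_points by (intro closed_UN) (auto intro: compact_imp_closed)
    show "continuous_on (edge_points e) (\<lambda>x. dist a x * dist b x)"
      by (intro continuous_intros)
    show "\<forall>x. x \<in> edge_points e \<and> x \<notin> edge_points e \<or> x \<in> (\<Union>e'\<in>edges G - {e}. edge_points e') \<and> x \<in> edge_points e
      \<longrightarrow> dist a x * dist b x = 0"
      using other unfolding w_def by (metis DiffD1 DiffD2 UN_E singletonI)
  qed simp
  moreover have "edge_points e \<union> (\<Union>e'\<in>edges G - {e}. edge_points e') = graph_points G"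
    unfolding graph_points_eq using e by blast
  ultimately have cont: "continuous_on (graph_points G) w" by simp
  have param: "on_edge w e t = t * (L - t)" if "t \<in> {0..L}" for t
  proof -
    have "edge_param e t \<in> edge_points e" using edge_param_in[OF e] that L by simp
    moreover have "edge_param e 0 = a" by (simp add: ab(1))
    moreover have "edge_param e L = b" using ab(2) by (simp add: ab(1) L_def sgn_div_norm dist_norm norm_minus_commute)
    ultimately show ?thesis
      using dist_edge_param[OF e, of 0 t] dist_edge_param[OF e, of L t] that by (simp add: on_edge_def w_def)
  qed
  have "on_edge w e' \<in> H1_interval {0<..<edge_length e'}" if e': "e' \<in> edges G" for e'
  proof -
    \<comment> \<open>Outside its edge, the restriction of \<open>w\<close> need not be smooth along
      the line. It is replaced by a function that is C1 on all of the line and agrees with it on the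
      open edge.\<close>
    obtain f f' where f: "\<And>t. t \<in> {0<..<edge_length e'} \<Longrightarrow> on_edge w e' t = f t"
      "\<And>x. (f has_real_derivative f' x) (at x)" "continuous_on UNIV f'"
    proof (cases "e' = e")
      case True
      show ?thesis
      proof (rule that[of "\<lambda>t. t * (L - t)" "\<lambda>t. L - 2 * t"])
        show "((\<lambda>t. t * (L - t)) has_real_derivative L - 2 * x) (at x)" for x
          by (auto intro!: derivative_eq_intros)
      qed (use True param L in \<open>auto intro!: continuous_intros\<close>)
    next
      case False
      have "on_edge w e' t = 0" if "t \<in> {0<..<edge_length e'}" for t
        unfolding on_edge_def using other[OF e' False edge_param_in[OF e', of t]] that by simp
      then show ?thesis by (intro that[of "\<lambda>_. 0" "\<lambda>_. 0"]) auto
    qed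
    have wd: "weak_derivative {0<..<edge_length e'} f f'"
      using edge_length_pos[OF e'] f(2,3) by (intro classical_imp_weak_derivative) auto
    have "(LINT t|interval_measure (edge_length e'). on_edge w e' t * \<phi> t)
      = (LINT t|interval_measure (edge_length e'). f t * \<phi> t)" for \<phi>
      by (rule Bochner_Integration.integral_cong) (simp_all add: f(1))
    then have "weak_derivative {0<..<edge_length e'} (on_edge w e') f'"
      using wd unfolding weak_derivative_interval by simp
    moreover have "L2_function (interval_measure (edge_length e')) f'"
      using f(3) by (intro continuous_imp_L2_function) (auto intro: continuous_on_subset)
    ultimately show ?thesis
      unfolding H1_interval_iff using continuous_imp_L2_function[OF continuous_on_edge[OF cont e']] by blast
  qed
  moreover have "w x = 0" if x: "x \<in> outer G" for x
  proof -
    obtain e' where e': "e' \<in> edges G" "x \<in> edge_ends e'"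
      using x by (auto simp: outer_def verts_eq)
    then have "x \<in> edge_points e'" using edge_ends_subset by blast
    then show ?thesis using ends other e' by (cases "e' = e") auto
  qed
  ultimately have "w \<in> H10 G"
    unfolding H10_iff continuous_H1_def using cont continuous_on_edge by blast
  moreover have "edge_param e (L / 2) \<in> graph_points G" "w (edge_param e (L / 2)) \<noteq> 0"
    using edge_param_in[OF e, of "L / 2"] param[of "L / 2"] L e
    by (auto simp: graph_points_eq on_edge_def)
  ultimately show ?thesis unfolding H10_nonzero_def by blast
qed

section \<open>Existence of a minimiser\<close>

lemma minimizer_exists:
  assumes p: "0 < p"
  defines "m \<equiv> INF w\<in>H10_nonzero G. H1_energy G w / Lp_norm_sq p G w"
  obtains v where "v \<in> H10_nonzero G" and "Lp_norm_sq p G v = 1" and "H1_energy G v = m"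
    and "0 < m" and "\<And>w. w \<in> H10 G \<Longrightarrow> m * Lp_norm_sq p G w \<le> H1_energy G w"
proof -
  let ?E = "H1_energy G" and ?N = "Lp_norm_sq p G"
  have N_pos: "0 < ?N w" if "w \<in> H10_nonzero G" for w
  proof -
    have "0 < Lp_mass p G w"
      using that Lp_mass_pos[OF p] by (auto simp: H10_nonzero_def)
    then show ?thesis by (simp add: Lp_norm_sq_eq)
  qed
  have bdd: "bdd_below ((\<lambda>w. ?E w / ?N w) ` H10_nonzero G)"
    using N_pos H1_energy_nonneg by (intro bdd_belowI2[of _ 0]) (simp add: less_imp_le)
  have m_le: "m \<le> ?E w / ?N w" if "w \<in> H10_nonzero G" for w
    unfolding m_def by (rule cINF_lower[OF bdd that])
  have m0: "0 \<le> m"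
    unfolding m_def using N_pos H1_energy_nonneg H10_nonzero_nonempty
    by (intro cINF_greatest) (auto simp: less_imp_le)
  have mN: "m * ?N w \<le> ?E w" if w: "w \<in> H10 G" for w
  proof (cases "w \<in> H10_nonzero G")
    case True
    then show ?thesis using m_le[OF True] N_pos[OF True] by (simp add: pos_le_divide_eq)
  next
    case False
    \<comment> \<open>The quotient defining \<open>m\<close> says nothing about such a
      \<open>w\<close>, but it vanishes on the whole graph and so its norm is 0.\<close>
    have "on_edge w e t = 0" if "e \<in> edges G" "t \<in> {0<..<edge_length e}" for e t
      using False w edge_param_in[OF that(1), of t] that
      by (auto simp: H10_nonzero_def on_edge_def graph_points_eq)
    then have "Lp_mass p G w = (\<Sum>e\<in>edges G. LINT t|interval_measure (edge_length e). 0)"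
      unfolding Lp_mass_eq
      by (intro sum.cong Bochner_Integration.integral_cong) auto
    then show ?thesis using H1_energy_nonneg by (simp add: Lp_norm_sq_eq)
  qed
  \<comment> \<open>\<open>Suc n\<close> keeps the gap positive at index 0, where division by 0
    would yield 0.\<close>
  have "\<exists>w\<in>H10 G. ?N w = 1 \<and> m \<le> ?E w \<and> ?E w < m + 1 / real (Suc n)" for n
  proof -
    obtain u where u: "u \<in> H10_nonzero G" "?E u / ?N u < m + 1 / real (Suc n)"
      using cINF_less_iff[OF H10_nonzero_nonempty bdd, of "m + 1 / real (Suc n)"]
      unfolding m_def by auto
    \<comment> \<open>Numerator and denominator are both homogeneous of degree 2, so this
      normalisation turns the quotient into the energy.\<close>
    define c where "c = 1 / sqrt (?N u)"
    have c: "c\<^sup>2 = 1 / ?N u" using N_pos[OF u(1)] by (simp add: c_def power_divide)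
    have uH: "u \<in> H10 G" using u by (simp add: H10_nonzero_def)
    have "(\<lambda>x. c * u x) \<in> H10 G"
      using H10_linear[OF uH uH, of c 0] by simp
    moreover have "?N (\<lambda>x. c * u x) = 1" "?E (\<lambda>x. c * u x) = ?E u / ?N u"
      using N_pos[OF u(1)] by (simp_all add: Lp_norm_sq_cmult[OF p] H1_energy_cmult[OF uH] c)
    ultimately show ?thesis using u(2) m_le[OF u(1)] by (intro bexI[of _ "\<lambda>x. c * u x"]) auto
  qed
  then obtain w where w: "\<And>n. w n \<in> H10 G" "\<And>n. ?N (w n) = 1" "\<And>n. m \<le> ?E (w n)"
    "\<And>n. ?E (w n) < m + 1 / real (Suc n)"
    by metis
  have bound: "?E (w n) \<le> m + 1" for n
  proof -
    have "1 / real (Suc n) \<le> 1" by simp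
    then show ?thesis using w(4)[of n] by linarith
  qed
  obtain C where C: "0 \<le> C" "\<And>w x. w \<in> H10 G \<Longrightarrow> x \<in> graph_points G \<Longrightarrow> (w x)\<^sup>2 \<le> C * ?E w"
    using H10_sup_bound by blast
  define B where "B = sqrt (C * (m + 1))"
  have B: "\<bar>w n x\<bar> \<le> B" if "x \<in> graph_points G" for n x
  proof -
    have "(w n x)\<^sup>2 \<le> C * ?E (w n)" by (rule C(2)[OF w(1) that])
    also have "\<dots> \<le> C * (m + 1)" using C(1) bound by (rule mult_left_mono[rotated])
    finally show ?thesis unfolding B_def using real_sqrt_le_mono by fastforce
  qed
  have equi: "\<exists>d>0. \<forall>n y. y \<in> graph_points G \<and> norm (x - y) < d \<longrightarrow> norm (w n x - w n y) < e"
    if x: "x \<in> graph_points G" and e: "0 < e" for x e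
  proof -
    have "0 \<le> m + 1" using m0 by simp
    from H10_equicontinuous[OF x e this] obtain d where d: "0 < d"
      "\<And>w y. w \<in> H10 G \<Longrightarrow> ?E w \<le> m + 1 \<Longrightarrow> y \<in> graph_points G \<Longrightarrow> dist x y < d \<Longrightarrow> \<bar>w x - w y\<bar> < e"
      by blast
    show ?thesis
      using d(1) d(2)[OF w(1) bound] by (intro exI[of _ d]) (auto simp: dist_norm)
  qed
  have norm_B: "norm (w n x) \<le> B" if "x \<in> graph_points G" for n x
    using B[OF that] by simp
  obtain v k where v: "continuous_on (graph_points G) v" and k: "strict_mono (k :: nat \<Rightarrow> nat)"
    and unif: "\<And>e. 0 < e \<Longrightarrow> \<exists>N. \<forall>n x. n \<ge> N \<and> x \<in> graph_points G \<longrightarrow> norm (w (k n) x - v x) < e"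
    using Arzela_Ascoli[OF compact_graph_points norm_B equi] by metis
  define W where "W n = w (k n)" for n
  have W: "W n \<in> H10 G" "?N (W n) = 1" for n
    using w by (auto simp: W_def)
  have WB: "\<bar>W n x\<bar> \<le> B" if "x \<in> graph_points G" for n x
    using B[OF that] by (simp add: W_def)
  have Wc: "continuous_on (graph_points G) (W n)" for n
    using W(1) by (simp add: H10_iff)
  have unifW: "\<exists>N. \<forall>n\<ge>N. \<forall>x\<in>graph_points G. \<bar>W n x - v x\<bar> < e" if "0 < e" for e
    using unif[OF that] by (auto simp: W_def)
  have ptw: "(\<lambda>n. W n x) \<longlonglongrightarrow> v x" if "x \<in> graph_points G" for x
    using unifW that by (intro LIMSEQ_I) (simp, meson)
  have EW: "(\<lambda>n. ?E (W n)) \<longlonglongrightarrow> m"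
  proof -
    have "(\<lambda>n. ?E (w n)) \<longlonglongrightarrow> m"
    proof (rule tendsto_sandwich[OF _ _ tendsto_const])
      show "(\<lambda>n. m + 1 / real (Suc n)) \<longlonglongrightarrow> m"
        using tendsto_add[OF tendsto_const LIMSEQ_inverse_real_of_nat, of m]
        by (simp add: inverse_eq_divide)
    qed (use w in \<open>auto intro!: always_eventually less_imp_le\<close>)
    then show ?thesis
      unfolding W_def using LIMSEQ_subseq_LIMSEQ[OF _ k] by (simp add: comp_def)
  qed
  have limN: "(\<lambda>n. ?N (u n)) \<longlonglongrightarrow> ?N u'"
    if "\<And>n. continuous_on (graph_points G) (u n)" "continuous_on (graph_points G) u'"
      "\<And>x. x \<in> graph_points G \<Longrightarrow> (\<lambda>n. u n x) \<longlonglongrightarrow> u' x"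
      "\<And>n x. x \<in> graph_points G \<Longrightarrow> \<bar>u n x\<bar> \<le> R" for u u' R
    unfolding Lp_norm_sq_eq using Lp_mass_limit[OF p that] p Lp_mass_nonneg
    by (intro tendsto_powr') auto
  have "(\<lambda>n. ?N (W n)) \<longlonglongrightarrow> ?N v" by (rule limN[OF Wc v ptw WB])
  then have Nv: "?N v = 1" using W(2) by (simp add: LIMSEQ_const_iff)
  have cauchy: "\<exists>N. \<forall>i\<ge>N. \<forall>j\<ge>N. ?E (\<lambda>x. W i x - W j x) < e" if e: "0 < e" for e
  proof (rule ccontr)
    assume "\<not> ?thesis"
    then have "\<forall>n. \<exists>i j. i \<ge> n \<and> j \<ge> n \<and> e \<le> ?E (\<lambda>x. W i x - W j x)"
      by (simp add: not_less)
    \<comment> \<open>Failure of the Cauchy property gives index sequences \<open>i n\<close>,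
      \<open>j n\<close> tending to infinity. Along both, \<open>W\<close> tends to
      \<open>v\<close>, so the squared norm of the sum tends to that of \<open>2 * v\<close>, which
      is 4.\<close>
    then obtain i j where ij: "\<And>n. i n \<ge> n" "\<And>n. j n \<ge> n" "\<And>n. e \<le> ?E (\<lambda>x. W (i n) x - W (j n) x)"
      by metis
    have at_top: "filterlim i at_top sequentially" "filterlim j at_top sequentially"
      using ij(1,2) by (auto intro!: filterlim_at_top_mono[OF filterlim_ident] always_eventually)
    have "(\<lambda>n. ?N (\<lambda>x. W (i n) x + W (j n) x)) \<longlonglongrightarrow> ?N (\<lambda>x. v x + v x)"
    proof (rule limN)
      show "\<bar>W (i n) x + W (j n) x\<bar> \<le> 2 * B" if "x \<in> graph_points G" for n x
        using WB[OF that, of "i n"] WB[OF that, of "j n"] by linarith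
      show "(\<lambda>n. W (i n) x + W (j n) x) \<longlonglongrightarrow> v x + v x" if "x \<in> graph_points G" for x
        using filterlim_compose[OF ptw[OF that] at_top(1)] filterlim_compose[OF ptw[OF that] at_top(2)]
        by (rule tendsto_add)
    qed (intro continuous_intros Wc v)+
    also have "?N (\<lambda>x. v x + v x) = 4"
      using Lp_norm_sq_cmult[OF p, of 2 v] Nv by (simp flip: mult_2)
    finally have N4: "(\<lambda>n. ?N (\<lambda>x. W (i n) x + W (j n) x)) \<longlonglongrightarrow> 4" .
    \<comment> \<open>The parallelogram identity and the Sobolev inequality for the sum bound the
      energy of the difference by this expression, whose limit is 0.\<close>
    have "(\<lambda>n. 2 * ?E (W (i n)) + 2 * ?E (W (j n)) - m * ?N (\<lambda>x. W (i n) x + W (j n) x))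
        \<longlonglongrightarrow> 2 * m + 2 * m - m * 4"
      by (intro tendsto_intros N4 filterlim_compose[OF EW at_top(1)] filterlim_compose[OF EW at_top(2)])
    moreover have "e \<le> 2 * ?E (W (i n)) + 2 * ?E (W (j n)) - m * ?N (\<lambda>x. W (i n) x + W (j n) x)" for n
    proof -
      have "(\<lambda>x. W (i n) x + W (j n) x) \<in> H10 G"
        using H10_linear[OF W(1)[of "i n"] W(1)[of "j n"], of 1 1] by simp
      from mN[OF this] ij(3)[of n] H1_energy_parallelogram[OF W(1)[of "i n"] W(1)[of "j n"]]
      show ?thesis by linarith
    qed
    ultimately have "e \<le> 2 * m + 2 * m - m * 4"
      by (intro LIMSEQ_le_const) auto
    then show False using e by simp
  qed
  have edge: "on_edge v e \<in> continuous_H1 (edge_length e)"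
    "(\<lambda>n. interval_energy (edge_length e) (on_edge (W n) e)) \<longlonglongrightarrow> interval_energy (edge_length e) (on_edge v e)"
    if e: "e \<in> edges G" for e
  proof -
    have 1: "on_edge (W n) e \<in> continuous_H1 (edge_length e)" for n
      using W(1) e by (simp add: H10_iff)
    have 2: "\<exists>N. \<forall>n\<ge>N. \<forall>t\<in>{0..edge_length e}. \<bar>on_edge (W n) e t - on_edge v e t\<bar> < d" if "0 < d" for d
    proof -
      have "edge_param e t \<in> graph_points G" if "t \<in> {0..edge_length e}" for t
        using edge_param_in[OF e that] e by (auto simp: graph_points_eq)
      then show ?thesis using unifW[OF that] unfolding on_edge_def by meson
    qed
    have 3: "\<exists>N. \<forall>i\<ge>N. \<forall>j\<ge>N. interval_energy (edge_length e) (\<lambda>t. on_edge (W i) e t - on_edge (W j) e t) < d"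
      if "0 < d" for d
    proof -
      have "interval_energy (edge_length e) (\<lambda>t. on_edge (W i) e t - on_edge (W j) e t)
        \<le> ?E (\<lambda>x. W i x - W j x)" for i j
        using interval_energy_le[OF e, of "\<lambda>x. W i x - W j x"] by (simp add: on_edge_def[abs_def])
      then show ?thesis using cauchy[OF that] by (meson le_less_trans)
    qed
    note continuous_H1_complete[OF edge_length_pos[OF e] 1 continuous_on_edge[OF v e] 2 3]
    then show "on_edge v e \<in> continuous_H1 (edge_length e)"
      "(\<lambda>n. interval_energy (edge_length e) (on_edge (W n) e)) \<longlonglongrightarrow> interval_energy (edge_length e) (on_edge v e)"
      by auto
  qed
  have "v x = 0" if x: "x \<in> outer G" for x
  proof -
    have "x \<in> graph_points G" using x by (auto simp: outer_def graph_points_def)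
    from ptw[OF this] show ?thesis using W(1) x by (simp add: H10_iff LIMSEQ_const_iff)
  qed
  then have vH: "v \<in> H10 G" using v edge(1) by (simp add: H10_iff)
  have "(\<lambda>n. ?E (W n)) \<longlonglongrightarrow> ?E v"
    unfolding H1_energy_eq by (intro tendsto_sum edge(2))
  then have Ev: "?E v = m" using EW by (rule LIMSEQ_unique)
  have "v \<in> H10_nonzero G"
  proof (rule ccontr)
    assume "v \<notin> H10_nonzero G"
    then have zero: "v x = 0" if "x \<in> graph_points G" for x
      using that vH by (auto simp: H10_nonzero_def)
    \<comment> \<open>On the graph \<open>v\<close> agrees with 0, hence the constant zero sequence
      converges to it and \<open>limN\<close> transfers the norm; away from the graph the two
      functions may differ.\<close>
    have "(\<lambda>_ :: nat. ?N (\<lambda>_. 0)) \<longlonglongrightarrow> ?N v"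
      using v zero by (intro limN[where R=0]) auto
    moreover have "?N (\<lambda>_. 0) = 0" using Lp_norm_sq_cmult[OF p, of 0 v] by simp
    ultimately show False using Nv by (simp add: LIMSEQ_const_iff)
  qed
  moreover from this obtain x where "x \<in> graph_points G" "v x \<noteq> 0"
    by (auto simp: H10_nonzero_def)
  \<comment> \<open>The sup bound at a point where \<open>v\<close> does not vanish excludes energy
    0.\<close>
  then have "0 < C * m" using C(2)[OF vH] Ev by (metis order_less_le_trans zero_less_power2)
  then have "0 < m" using C(1) m0 by (simp add: zero_less_mult_iff)
  ultimately show ?thesis using that Nv Ev mN by blast
qed

end

theorem proposition4:
  fixes p :: real and G :: plane_graph
  assumes "p > 2" and "metric_graph G" and "locally_finite_graph G" and "bounded_graph G"
  shows "1 / best_constant p G = (INF w\<in>H10_nonzero G. H1_energy G w / Lp_norm_sq p G w)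
    \<and> (\<forall>w\<in>H10 G. Lp_norm_sq p G w \<le> best_constant p G * H1_energy G w)
    \<and> (\<exists>v\<in>H10_nonzero G.
        H1_energy G v / Lp_norm_sq p G v = (INF w\<in>H10_nonzero G. H1_energy G w / Lp_norm_sq p G w)
        \<and> Lp_norm_sq p G v = best_constant p G * H1_energy G v)"
proof -
  interpret compact_metric_graph G
    using assms by (simp add: compact_metric_graph_def compact_metric_graph_axioms_def)
  define m where "m = (INF w\<in>H10_nonzero G. H1_energy G w / Lp_norm_sq p G w)"
  obtain v where v: "v \<in> H10_nonzero G" "Lp_norm_sq p G v = 1" "H1_energy G v = m"
    and m: "0 < m" "\<And>w. w \<in> H10 G \<Longrightarrow> m * Lp_norm_sq p G w \<le> H1_energy G w"
    using minimizer_exists[of p] assms(1) unfolding m_def by auto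
  \<comment> \<open>The admissible constants form a closed ray: \<open>v\<close>, with norm 1 and
    energy \<open>m\<close>, forces \<open>1 \<le> C * m\<close>, and the inequality with
    \<open>m\<close> gives the converse. Positivity of \<open>m\<close> makes \<open>1 / m\<close> a
    genuine reciprocal.\<close>
  have "{C. \<forall>w\<in>H10 G. Lp_norm_sq p G w \<le> C * H1_energy G w} = {1 / m..}"
  proof (intro equalityI subsetI)
    fix C assume "C \<in> {C. \<forall>w\<in>H10 G. Lp_norm_sq p G w \<le> C * H1_energy G w}"
    then have "1 \<le> C * m" using v by (auto simp: H10_nonzero_def)
    then show "C \<in> {1 / m..}" using m(1) by (simp add: pos_divide_le_eq)
  next
    fix C assume "C \<in> {1 / m..}"
    then have C: "1 / m \<le> C" by simp
    have "Lp_norm_sq p G w \<le> C * H1_energy G w" if "w \<in> H10 G" for w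
    proof -
      have "Lp_norm_sq p G w \<le> 1 / m * H1_energy G w"
        using m(2)[OF that] m(1) by (simp add: pos_le_divide_eq mult.commute)
      also have "\<dots> \<le> C * H1_energy G w"
        using C H1_energy_nonneg by (rule mult_right_mono)
      finally show ?thesis .
    qed
    then show "C \<in> {C. \<forall>w\<in>H10 G. Lp_norm_sq p G w \<le> C * H1_energy G w}" by blast
  qed
  then have best: "best_constant p G = 1 / m" by (simp add: best_constant_def)
  show ?thesis
    unfolding m_def[symmetric] best
  proof (intro conjI ballI bexI[of _ v])
    show "Lp_norm_sq p G w \<le> 1 / m * H1_energy G w" if "w \<in> H10 G" for w
      using m(2)[OF that] m(1) by (simp add: pos_le_divide_eq mult.commute)
  qed (use v m(1) in auto)
qed

end
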